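(* The following problem is decidable. Input: a finite alphabet $\Sigma$, an arbitrary finite max-plus automaton $A$ over $\Sigma$ with weights in $\mathbb{Z}\cup\{-\infty\}$ (any finite number of states), and a max-plus automaton $B$ over $\Sigma$ with weights in $\mathbb{Z}\cup\{-\infty\}$ and at most two states. Question: does $$[\![A]\!](w)\le [\![B]\!](w)\qquad\text{hold for every } w\in\Sigma^*?$$
   Context: $\mathbb{Z}_{\max}=(\mathbb{Z}\cup\{-\infty\},\max,+)$ is the max-plus semiring, with $-\infty$ absorbing for $+$ and least in the order $\le$ (so $-\infty\le x$ for all $x$, and $-\infty\le-\infty$). A finite max-plus automaton $A$ over a finite alphabet $\Sigma$ with $d$ states consists of an initial row vector $\lambda\in\mathbb{Z}_{\max}^{1\times d}$, a transition matrix $M_\sigma\in\mathbb{Z}_{\max}^{d\times d}$ for each $\sigma\in\Sigma$, and a final column vector $\phi\in\mathbb{Z}_{\max}^{d\times 1}$; all weights are arbitrary elements of $\mathbb{Z}\cup\{-\infty\}$. It computes the series $[\![A]\!]:\Sigma^*\to\mathbb{Z}\cup\{-\infty\}$ given by $[\![A]\!](\sigma_1\cdots\sigma_n)=\lambda M_{\sigma_1}\cdots M_{\sigma_n}\phi$ (max-plus matrix products; the empty word has value $\lambda\phi$). Equivalently, $[\![A]\!](w)$ is the maximum weight of a run on $w$, the weight of a run being the sum of its initial weight, its transition weights and its final weight. Decidable means that there is an algorithm that, on input (finite descriptions of) $\Sigma$, $A$, $B$, always terminates with the correct yes/no answer. *)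

theory Defs
  imports "Jordan_Normal_Form.Matrix" "HOL-Library.Nat_Bijection"
begin

section \<open>The max-plus semiring\<close>

text \<open>
  The ring-style class operations carry the max-plus structure: \<open>+\<close> is \<open>max\<close>, \<open>*\<close> is addition of
  weights, \<open>0\<close> is \<open>NegInf\<close> and \<open>1\<close> is \<open>Fin 0\<close>.  Hence matrix products over \<open>zmax\<close> are max-plus
  products.
\<close>

datatype zmax = NegInf | Fin int

instantiation zmax :: linorder
begin

fun less_eq_zmax :: "zmax \<Rightarrow> zmax \<Rightarrow> bool" where
  "NegInf \<le> y \<longleftrightarrow> True"
| "Fin a \<le> NegInf \<longleftrightarrow> False"
| "Fin a \<le> Fin b \<longleftrightarrow> a \<le> b"

definition less_zmax :: "zmax \<Rightarrow> zmax \<Rightarrow> bool" where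
  "x < y \<longleftrightarrow> x \<le> y \<and> \<not> y \<le> (x::zmax)"

instance
proof
  fix x y z :: zmax
  show "x < y \<longleftrightarrow> x \<le> y \<and> \<not> y \<le> x" by (rule less_zmax_def)
  show "x \<le> x" by (cases x) auto
  show "x \<le> z" if "x \<le> y" "y \<le> z" using that by (cases x; cases y; cases z) auto
  show "x = y" if "x \<le> y" "y \<le> x" using that by (cases x; cases y) auto
  show "x \<le> y \<or> y \<le> x" by (cases x; cases y) auto
qed

end

instantiation zmax :: comm_semiring_1
begin

definition zero_zmax :: zmax where "0 = NegInf"
definition one_zmax :: zmax where "1 = Fin 0"
definition plus_zmax :: "zmax \<Rightarrow> zmax \<Rightarrow> zmax" where "x + y = max x (y::zmax)"

fun times_zmax :: "zmax \<Rightarrow> zmax \<Rightarrow> zmax" where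
  "Fin a * Fin b = Fin (a + b)"
| "NegInf * y = NegInf"
| "x * NegInf = NegInf"

instance
proof
  fix x y z :: zmax
  show "x + y + z = x + (y + z)" by (simp add: plus_zmax_def max.assoc)
  show "x + y = y + x" by (simp add: plus_zmax_def max.commute)
  show "0 + x = x" by (cases x) (auto simp: plus_zmax_def zero_zmax_def max_def)
  show "x * y * z = x * (y * z)" by (cases x; cases y; cases z) auto
  show "x * y = y * x" by (cases x; cases y) auto
  show "1 * x = x" by (cases x) (auto simp: one_zmax_def)
  show "(x + y) * z = x * z + y * z"
    by (cases x; cases y; cases z) (auto simp: plus_zmax_def max_def)
  show "0 * x = 0" by (simp add: zero_zmax_def)
  show "x * 0 = 0" by (cases x) (auto simp: zero_zmax_def)
  show "(0::zmax) \<noteq> 1" by (simp add: zero_zmax_def one_zmax_def)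
qed

end

section \<open>Max-plus automata\<close>

text \<open>
  Since only a finite description of the alphabet is available to an algorithm, an alphabet with
  \<open>k\<close> letters is \<open>{..<k}\<close>; words over it are the elements of \<open>lists {..<k}\<close>.
\<close>

record mp_automaton =
  states :: nat
  initial :: "zmax vec"
  transition :: "nat \<Rightarrow> zmax mat"
  final :: "zmax vec"

definition valid_mp_automaton :: "nat \<Rightarrow> mp_automaton \<Rightarrow> bool" where
  "valid_mp_automaton k A \<longleftrightarrow>
     initial A \<in> carrier_vec (states A) \<and>
     (\<forall>\<sigma><k. transition A \<sigma> \<in> carrier_mat (states A) (states A)) \<and>
     final A \<in> carrier_vec (states A)"

fun word_mat :: "mp_automaton \<Rightarrow> nat list \<Rightarrow> zmax mat" where
  "word_mat A [] = 1\<^sub>m (states A)"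
| "word_mat A (\<sigma> # w) = transition A \<sigma> * word_mat A w"

definition series :: "mp_automaton \<Rightarrow> nat list \<Rightarrow> zmax" where
  "series A w = initial A \<bullet> (word_mat A w *\<^sub>v final A)"

section \<open>Partial recursive functions and decidability\<close>

datatype recf = Zero | Succ | Proj nat | Comp recf "recf list" | Prim recf recf | Mu recf

text \<open>
  \<open>computes p xs y\<close>: the partial recursive function denoted by \<open>p\<close> is defined on the argument tuple
  \<open>xs\<close>, with value \<open>y\<close>.  A program diverges on \<open>xs\<close> if there is no such \<open>y\<close>.
\<close>

inductive computes :: "recf \<Rightarrow> nat list \<Rightarrow> nat \<Rightarrow> bool" where
  Zero: "computes Zero xs 0"
| Succ: "computes Succ [x] (Suc x)"
| Proj: "i < length xs \<Longrightarrow> computes (Proj i) xs (xs ! i)"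
| Comp: "list_all2 (\<lambda>g y. computes g xs y) gs ys \<Longrightarrow> computes f ys z \<Longrightarrow> computes (Comp f gs) xs z"
| Prim_0: "computes f xs y \<Longrightarrow> computes (Prim f g) (0 # xs) y"
| Prim_Suc: "computes (Prim f g) (n # xs) y \<Longrightarrow> computes g (n # y # xs) z \<Longrightarrow>
    computes (Prim f g) (Suc n # xs) z"
| Mu: "computes f (n # xs) 0 \<Longrightarrow> \<forall>m<n. \<exists>y. computes f (m # xs) (Suc y) \<Longrightarrow>
    computes (Mu f) xs n"

inductive_cases computes_elims:
  "computes Zero xs y"
  "computes Succ xs y"
  "computes (Proj i) xs y"
  "computes (Comp f gs) xs y"
  "computes (Prim f g) (0 # xs) y"
  "computes (Prim f g) (Suc n # xs) y"
  "computes (Mu f) xs y"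

lemma computes_deterministic:
  assumes "computes p xs y" "computes p xs y'"
  shows "y = y'"
  using assms
proof (induction arbitrary: y' rule: computes.induct)
  case (Zero xs)
  from Zero.prems show ?case by (rule computes_elims(1)) simp
next
  case (Succ x)
  from Succ.prems show ?case by (rule computes_elims(2)) simp
next
  case (Proj i xs)
  from Proj.prems show ?case by (rule computes_elims(3)) simp
next
  case (Comp xs gs ys f z)
  from Comp.prems obtain ys' where
    ys': "list_all2 (\<lambda>g y. computes g xs y) gs ys'" and z: "computes f ys' y'"
    by (rule computes_elims(4))
  have "ys = ys'"
  proof (rule nth_equalityI)
    show "length ys = length ys'"
      using list_all2_lengthD[OF Comp.IH(1)] list_all2_lengthD[OF ys'] by simp
  next
    fix i
    assume "i < length ys"
    then have i: "i < length gs" using list_all2_lengthD[OF Comp.IH(1)] by simp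
    show "ys ! i = ys' ! i"
      using list_all2_nthD[OF Comp.IH(1) i] list_all2_nthD[OF ys' i] by blast
  qed
  then show ?case using Comp.IH(2) z by blast
next
  case (Prim_0 f xs y g)
  from Prim_0.prems have "computes f xs y'" by (rule computes_elims(5))
  then show ?case by (rule Prim_0.IH)
next
  case (Prim_Suc f g n xs y z)
  from Prim_Suc.prems obtain u where
    u: "computes (Prim f g) (n # xs) u" and z: "computes g (n # u # xs) y'"
    by (rule computes_elims(6))
  have "y = u" using u by (rule Prim_Suc.IH(1))
  with z show ?case using Prim_Suc.IH(2) by blast
next
  case (Mu f n xs)
  from Mu.prems have y': "computes f (y' # xs) 0"
    and below: "\<And>m. m < y' \<Longrightarrow> \<exists>y. computes f (m # xs) (Suc y)"
    by (rule computes_elims(7), simp)+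
  have "\<not> y' < n"
  proof
    assume "y' < n"
    then obtain v where "\<forall>u. computes f (y' # xs) u \<longrightarrow> Suc v = u" using Mu.IH(2) by blast
    then show False using y' by blast
  qed
  moreover have "\<not> n < y'"
  proof
    assume "n < y'"
    then obtain v where "computes f (n # xs) (Suc v)" using below by blast
    then have "0 = Suc v" by (rule Mu.IH(1))
    then show False by simp
  qed
  ultimately show ?case by simp
qed

text \<open>
  The yes/no question \<open>P\<close> about the inputs in \<open>I\<close>, where \<open>code x\<close> is the natural number presented
  to the algorithm on input \<open>x\<close>.  Nothing is required on numbers that are not codes of inputs.
\<close>

definition decidable :: "('a \<Rightarrow> nat) \<Rightarrow> 'a set \<Rightarrow> ('a \<Rightarrow> bool) \<Rightarrow> bool" where
  "decidable code I P \<longleftrightarrow> (\<exists>p. \<forall>x\<in>I. computes p [code x] (if P x then 1 else 0))"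

section \<open>Finite descriptions\<close>

fun code_zmax :: "zmax \<Rightarrow> nat" where
  "code_zmax NegInf = 0"
| "code_zmax (Fin a) = Suc (int_encode a)"

definition code_vec :: "zmax vec \<Rightarrow> nat" where
  "code_vec v = list_encode (map code_zmax (list_of_vec v))"

definition code_mat :: "zmax mat \<Rightarrow> nat" where
  "code_mat M = list_encode (map code_vec (rows M))"

definition code_automaton :: "nat \<Rightarrow> mp_automaton \<Rightarrow> nat" where
  "code_automaton k A = list_encode
     [states A, code_vec (initial A), list_encode (map (\<lambda>\<sigma>. code_mat (transition A \<sigma>)) [0..<k]),
      code_vec (final A)]"

fun code_instance :: "nat \<times> mp_automaton \<times> mp_automaton \<Rightarrow> nat" where
  "code_instance (k, A, B) = list_encode [k, code_automaton k A, code_automaton k B]"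

end

theory Submission
  imports Defs
begin

text \<open>
  Subtracting the weight of a run of \<open>A\<close> from the weights of the runs of \<open>B\<close> turns containment into
  the question whether every vector \<open>(x, y)\<close> that reaches the final state of a finite graph with
  edges labelled by two-by-two max-plus matrices is nonnegative.  When \<open>D = x - y\<close> is large, each
  matrix either shifts \<open>D\<close> by a bounded amount or forgets one of the two components; so \<open>D\<close> behaves
  like the counter of a one-counter automaton.  Cutting the values of \<open>D\<close> into blocks of a length \<open>N\<close>
  that exceeds all differences within a matrix makes the counter move by at most one block per step,
  and the infima of the weights reachable in finitely many kinds of configurations, together with
  the infima over the excursions that return to the block they started from, form a finite
  certificate of nonnegativity that is checked by local inequalities.  Hence both containment and its
  negation are semidecidable.
\<close>

section \<open>Total recursive functions\<close>

text \<open>The obstacle is that D is unbounded while a certificate has finitely many entries. A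
  bound on \<open>u\<close> taken over all levels cannot follow a path back down, since it has
  forgotten the level, and one bound for each level would be an infinite table. Above the first
  level, descents are therefore never recorded as steps of their own: a climb that later returns to
  its level is folded, with everything above it, into an excursion. An excursion uses only edges
  that shift D, so it changes \<open>u\<close> by an amount that does not depend on the level.
  Climbs that never return are seen only through bounds that are uniform in the level. The bound on
  \<open>l\<close> is kept separately, because an edge that forgets \<open>u\<close> on a high level
  hands on \<open>l\<close> alone, and no finite table relates the two components there. That
  \<open>B\<close> has at most two states leaves a single difference and hence a single counter. The
  infima are never computed: it is enough that they exist and that every table satisfying the
  inequalities is sound, so one search runs through all certificates and all path lengths
  together.\<close>

definition recursive :: "nat \<Rightarrow> (nat list \<Rightarrow> nat) \<Rightarrow> bool" where
  "recursive n f \<longleftrightarrow> (\<exists>p. \<forall>xs. length xs = n \<longrightarrow> computes p xs (f xs))"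

abbreviation recursive1 :: "(nat \<Rightarrow> nat) \<Rightarrow> bool" where
  "recursive1 f \<equiv> recursive 1 (\<lambda>xs. f (xs ! 0))"

abbreviation recursive2 :: "(nat \<Rightarrow> nat \<Rightarrow> nat) \<Rightarrow> bool" where
  "recursive2 f \<equiv> recursive 2 (\<lambda>xs. f (xs ! 0) (xs ! 1))"

abbreviation recursive3 :: "(nat \<Rightarrow> nat \<Rightarrow> nat \<Rightarrow> nat) \<Rightarrow> bool" where
  "recursive3 f \<equiv> recursive 3 (\<lambda>xs. f (xs ! 0) (xs ! 1) (xs ! 2))"

lemma recursive_nth: "i < n \<Longrightarrow> recursive n (\<lambda>xs. xs ! i)"
  unfolding recursive_def by (rule exI[of _ "Proj i"]) (auto intro: computes.Proj)

lemma recursive_comp: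
  assumes g: "recursive (length fs) g" and fs: "\<And>f. f \<in> set fs \<Longrightarrow> recursive n f"
  shows "recursive n (\<lambda>xs. g (map (\<lambda>f. f xs) fs))"
proof -
  obtain q where q: "\<And>xs. length xs = length fs \<Longrightarrow> computes q xs (g xs)"
    using g unfolding recursive_def by blast
  have "\<forall>f\<in>set fs. \<exists>p. \<forall>xs. length xs = n \<longrightarrow> computes p xs (f xs)"
    using fs unfolding recursive_def by blast
  then obtain p where p: "\<And>f xs. f \<in> set fs \<Longrightarrow> length xs = n \<Longrightarrow> computes (p f) xs (f xs)"
    by metis
  have "computes (Comp q (map p fs)) xs (g (map (\<lambda>f. f xs) fs))" if "length xs = n" for xs
    by (rule computes.Comp[where ys = "map (\<lambda>f. f xs) fs"])
      (auto simp: list_all2_conv_all_nth intro: p that q)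
  then show ?thesis unfolding recursive_def by blast
qed

lemma recursive_comp1:
  assumes "recursive1 g" "recursive n f"
  shows "recursive n (\<lambda>xs. g (f xs))"
  using recursive_comp[where fs = "[f]" and g = "\<lambda>xs. g (xs ! 0)"] assms by simp

lemma recursive_comp2:
  assumes "recursive2 g" "recursive n f" "recursive n f'"
  shows "recursive n (\<lambda>xs. g (f xs) (f' xs))"
  using recursive_comp[where fs = "[f, f']" and g = "\<lambda>xs. g (xs ! 0) (xs ! 1)"] assms
  by (auto simp: numeral_2_eq_2)

lemma recursive_comp3:
  assumes "recursive3 g" "recursive n f" "recursive n f'" "recursive n f''"
  shows "recursive n (\<lambda>xs. g (f xs) (f' xs) (f'' xs))"
  using recursive_comp[where fs = "[f, f', f'']" and g = "\<lambda>xs. g (xs ! 0) (xs ! 1) (xs ! 2)"] assms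
  by (auto simp: numeral_2_eq_2 numeral_3_eq_3)

lemma recursive_Suc: "recursive n f \<Longrightarrow> recursive n (\<lambda>xs. Suc (f xs))"
proof (erule recursive_comp1[rotated])
  have "computes Succ xs (Suc (xs ! 0))" if "length xs = 1" for xs
    using that by (cases xs) (auto intro: computes.Succ)
  then show "recursive1 Suc" unfolding recursive_def by blast
qed

lemma recursive_const: "recursive n (\<lambda>_. c)"
proof (induction c)
  case 0
  show ?case unfolding recursive_def by (blast intro: computes.Zero)
qed (rule recursive_Suc)

lemma recursive2_prim:
  assumes f: "recursive1 f" and g: "recursive3 g"
    and F0: "\<And>y. F 0 y = f y" and FSuc: "\<And>m y. F (Suc m) y = g m (F m y) y"
  shows "recursive2 F"
proof -
  obtain p q where p: "\<And>xs. length xs = 1 \<Longrightarrow> computes p xs (f (xs ! 0))"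
    and q: "\<And>xs. length xs = 3 \<Longrightarrow> computes q xs (g (xs ! 0) (xs ! 1) (xs ! 2))"
    using f g unfolding recursive_def by blast
  have "computes (Prim p q) [m, y] (F m y)" for m y
  proof (induction m)
    case 0
    show ?case using p[of "[y]"] by (auto simp: F0 intro: computes.Prim_0)
  next
    case (Suc m)
    show ?case using q[of "[m, F m y, y]"] by (auto simp: FSuc intro: computes.Prim_Suc[OF Suc])
  qed
  then have "computes (Prim p q) xs (F (xs ! 0) (xs ! 1))" if "length xs = 2" for xs
    using that by (cases xs; cases "tl xs") auto
  then show ?thesis unfolding recursive_def by blast
qed

lemma recursive1_prim:
  assumes g: "recursive2 g" and FSuc: "\<And>m. F (Suc m) = g m (F m)"
  shows "recursive1 F"
proof -
  have "recursive2 (\<lambda>m _. F m)"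
    by (rule recursive2_prim[where g = "\<lambda>m v _. g m v" and f = "\<lambda>_. F 0"])
      (auto intro!: recursive_const recursive_comp2[OF g] recursive_nth FSuc)
  from recursive_comp2[OF this] show ?thesis by (auto intro: recursive_nth)
qed

section \<open>Arithmetic, branching and the inverse of Cantor pairing\<close>

lemma recursive2_add: "recursive2 (+)"
  by (rule recursive2_prim[where f = "\<lambda>y. y" and g = "\<lambda>m v y. Suc v"])
    (auto intro!: recursive_nth recursive_Suc)

lemma recursive1_pred: "recursive1 (\<lambda>x. x - 1)"
  by (rule recursive1_prim[where g = "\<lambda>m v. m"]) (auto intro!: recursive_nth)

lemma recursive2_diff: "recursive2 (-)"
proof -
  have "recursive2 (\<lambda>y x. x - y)"
    by (rule recursive2_prim[where f = "\<lambda>y. y" and g = "\<lambda>m v y. v - 1"])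
      (auto intro!: recursive_nth recursive_comp1[OF recursive1_pred] simp del: One_nat_def)
  from recursive_comp2[OF this recursive_nth[of 1 2] recursive_nth[of 0 2]]
  show ?thesis by (auto intro: recursive_nth)
qed

lemma recursive2_times: "recursive2 (*)"
  by (rule recursive2_prim[where f = "\<lambda>y. 0" and g = "\<lambda>m v y. y + v"])
    (auto intro!: recursive_nth recursive_const recursive_comp2[OF recursive2_add])

lemma recursive1_is_zero: "recursive1 (\<lambda>x. if x = 0 then 1 else 0)"
  using recursive_comp2[OF recursive2_diff recursive_const[of 1 1] recursive_nth[of 0 1]]
  by (rule back_subst[of "recursive 1"]) (auto simp: fun_eq_iff)

text \<open>Branching is a sum of two guarded terms of which at least one vanishes; a guard is a
  primitive recursion whose step ignores the previous value.\<close>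

lemma recursive3_If: "recursive3 (\<lambda>c x y. if c = 0 then y else x)"
proof -
  have "recursive2 (\<lambda>c x. if c = 0 then 0 else x)"
    by (rule recursive2_prim[where f = "\<lambda>y. 0" and g = "\<lambda>m v y. y"])
      (auto intro!: recursive_nth recursive_const)
  note guard = recursive_comp2[OF this]
  have "recursive 3 (\<lambda>xs. (if xs ! 0 = 0 then 0 else xs ! 1) +
      (if (if xs ! 0 = 0 then 1 else 0) = (0::nat) then 0 else xs ! 2))"
    by (intro recursive_comp2[OF recursive2_add] guard recursive_comp1[OF recursive1_is_zero]
        recursive_nth) auto
  then show ?thesis by (rule back_subst[of "recursive 3"]) (auto simp: fun_eq_iff)
qed

lemma recursive1_triangle: "recursive1 triangle"
  by (rule recursive1_prim[where g = "\<lambda>m v. v + Suc m"])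
    (auto intro!: recursive_comp2[OF recursive2_add] recursive_nth recursive_Suc)

lemma recursive2_prod_encode: "recursive2 (\<lambda>x y. prod_encode (x, y))"
  unfolding prod_encode_def
  by (auto intro!: recursive_comp2[OF recursive2_add] recursive_nth recursive_comp1[OF recursive1_triangle])

abbreviation nat_fst :: "nat \<Rightarrow> nat" where
  "nat_fst c \<equiv> fst (prod_decode c)"

abbreviation nat_snd :: "nat \<Rightarrow> nat" where
  "nat_snd c \<equiv> snd (prod_decode c)"

text \<open>Cantor pairing sends (x, y) to \<open>triangle (x + y) + x\<close>, so a code is
  inverted as soon as x + y is known.\<close>

definition diagonal :: "nat \<Rightarrow> nat" where
  "diagonal c = nat_fst c + nat_snd c"

lemma triangle_diagonal: "c = triangle (diagonal c) + nat_fst c"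
  using prod_decode_inverse[of c]
  by (cases "prod_decode c") (auto simp: prod_encode_def diagonal_def)

lemma triangle_mono: "i \<le> j \<Longrightarrow> triangle i \<le> triangle j"
  by (induction j) (auto simp: le_Suc_eq)

lemma diagonal_unique:
  assumes "triangle d \<le> c" "c < triangle (Suc d)"
  shows "diagonal c = d"
proof (rule ccontr)
  assume "diagonal c \<noteq> d"
  moreover have "triangle (diagonal c) \<le> c" "c < triangle (Suc (diagonal c))"
    using triangle_diagonal[of c] by (auto simp: diagonal_def)
  ultimately show False
    using assms triangle_mono[of "Suc d" "diagonal c"] triangle_mono[of "Suc (diagonal c)" d]
    by linarith
qed

text \<open>The index moves on exactly when \<open>Suc c\<close> is the next triangular number.
  Equality is phrased as two vanishing truncated differences because these are tests that
  \<open>recursive2_diff\<close> and \<open>recursive3_If\<close> can express.\<close>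

lemma diagonal_Suc:
  "diagonal (Suc c) = (if Suc c - triangle (Suc (diagonal c)) = 0
    then (if triangle (Suc (diagonal c)) - Suc c = 0 then Suc (diagonal c) else diagonal c)
    else diagonal c)"
proof -
  have "triangle (diagonal c) \<le> c" "c < triangle (Suc (diagonal c))"
    using triangle_diagonal[of c] by (auto simp: diagonal_def)
  then show ?thesis by (auto intro!: diagonal_unique)
qed

lemma recursive1_diagonal: "recursive1 diagonal"
proof (rule recursive1_prim[where g = "\<lambda>c d. if Suc c - triangle (Suc d) = 0
    then (if triangle (Suc d) - Suc c = 0 then Suc d else d) else d"])
  have If: "recursive n f \<Longrightarrow> recursive n g \<Longrightarrow> recursive n h
      \<Longrightarrow> recursive n (\<lambda>xs. if f xs = 0 then g xs else h xs)" for n f g h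
    using recursive_comp3[OF recursive3_If, of n f h g] by simp
  show "recursive2 (\<lambda>c d. if Suc c - triangle (Suc d) = 0
    then (if triangle (Suc d) - Suc c = 0 then Suc d else d) else d)"
    by (intro If recursive_comp2[OF recursive2_diff] recursive_Suc recursive_nth
        recursive_comp1[OF recursive1_triangle]) auto
qed (rule diagonal_Suc)

lemma recursive1_nat_fst: "recursive1 nat_fst"
proof -
  have "recursive 1 (\<lambda>xs. xs ! 0 - triangle (diagonal (xs ! 0)))"
    by (intro recursive_comp2[OF recursive2_diff] recursive_nth
        recursive_comp1[OF recursive1_triangle] recursive_comp1[OF recursive1_diagonal]) auto
  also have "(\<lambda>xs. xs ! 0 - triangle (diagonal (xs ! 0))) = (\<lambda>xs. nat_fst (xs ! 0))"
    using triangle_diagonal by (metis add_diff_cancel_left')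
  finally show ?thesis .
qed

lemma recursive1_nat_snd: "recursive1 nat_snd"
proof -
  have "recursive 1 (\<lambda>xs. diagonal (xs ! 0) - nat_fst (xs ! 0))"
    by (intro recursive_comp2[OF recursive2_diff] recursive_nth
        recursive_comp1[OF recursive1_nat_fst] recursive_comp1[OF recursive1_diagonal]) auto
  also have "(\<lambda>xs. diagonal (xs ! 0) - nat_fst (xs ! 0)) = (\<lambda>xs. nat_snd (xs ! 0))"
    by (auto simp: diagonal_def)
  finally show ?thesis .
qed

section \<open>Computable functions between coded types\<close>

text \<open>Bijectivity makes every number a code, so \<open>dec\<close> is total and a search
  through a coded type is a search through the numbers. The instances for lists, integers and
  weights use the same codings as \<open>code_instance\<close>, so inputs can be read with
  \<open>dec\<close>.\<close>

class coded =
  fixes enc :: "'a \<Rightarrow> nat"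
  assumes bij_enc: "bij enc"
begin

definition dec :: "nat \<Rightarrow> 'a" where
  "dec = inv_into UNIV enc"

lemma dec_enc [simp]: "dec (enc x) = x"
  unfolding dec_def using bij_enc by (simp add: bij_is_inj)

lemma enc_dec [simp]: "enc (dec n) = n"
  unfolding dec_def using bij_enc by (simp add: bij_is_surj surj_f_inv_f)

lemma enc_eq_iff [simp]: "enc x = enc y \<longleftrightarrow> x = y"
  by (metis dec_enc)

end

instantiation nat :: coded
begin
definition enc_nat :: "nat \<Rightarrow> nat" where "enc_nat n = n"
instance by standard (auto simp: enc_nat_def bij_def inj_def)
end

instantiation prod :: (coded, coded) coded
begin
definition enc_prod :: "'a \<times> 'b \<Rightarrow> nat" where "enc_prod z = prod_encode (map_prod enc enc z)"
instance
proof
  have "bij (map_prod (enc :: 'a \<Rightarrow> nat) (enc :: 'b \<Rightarrow> nat))"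
    using bij_enc[where 'a = 'a] bij_enc[where 'a = 'b] unfolding bij_def
    by (intro conjI prod.inj_map map_prod_surj) auto
  then have "bij (prod_encode \<circ> map_prod (enc :: 'a \<Rightarrow> nat) (enc :: 'b \<Rightarrow> nat))"
    using bij_prod_encode by (rule bij_comp)
  then show "bij (enc :: 'a \<times> 'b \<Rightarrow> nat)" by (simp add: enc_prod_def[abs_def] comp_def)
qed
end

instantiation list :: (coded) coded
begin
definition enc_list :: "'a list \<Rightarrow> nat" where "enc_list xs = list_encode (map enc xs)"
instance
proof
  have "bij (map (enc :: 'a \<Rightarrow> nat))"
    using bij_enc[where 'a = 'a] lists_image[of "enc :: 'a \<Rightarrow> nat" UNIV]
    unfolding bij_def by (metis lists_UNIV list.inj_map)
  then have "bij (list_encode \<circ> map (enc :: 'a \<Rightarrow> nat))"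
    using bij_list_encode by (rule bij_comp)
  then show "bij (enc :: 'a list \<Rightarrow> nat)" by (simp add: enc_list_def[abs_def] comp_def)
qed
end

instantiation int :: coded
begin
definition enc_int :: "int \<Rightarrow> nat" where "enc_int = int_encode"
instance by standard (simp add: enc_int_def bij_int_encode)
end

instantiation zmax :: coded
begin
definition enc_zmax :: "zmax \<Rightarrow> nat" where "enc_zmax = code_zmax"
instance
proof
  have "inj code_zmax"
  proof (rule injI)
    fix x y assume "code_zmax x = code_zmax y"
    then show "x = y" by (cases x; cases y) (auto simp: int_encode_eq)
  qed
  moreover have "n \<in> range code_zmax" for n
  proof (cases n)
    case 0
    then have "n = code_zmax NegInf" by simp
    then show ?thesis by blast
  next
    case (Suc m)
    then have "n = code_zmax (Fin (int_decode m))" by simp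
    then show ?thesis by blast
  qed
  ultimately show "bij (enc :: zmax \<Rightarrow> nat)" by (auto simp: bij_def enc_zmax_def)
qed
end

lemma enc_Pair: "enc (x, y) = prod_encode (enc x, enc y)"
  by (simp add: enc_prod_def)

lemma dec_nat: "dec n = (n :: nat)"
  using dec_enc[of n] by (simp add: enc_nat_def)

lemma dec_prod: "dec n = (dec (fst (prod_decode n)), dec (snd (prod_decode n)))"
proof -
  have "enc (dec (fst (prod_decode n)) :: 'a, dec (snd (prod_decode n)) :: 'b) = n"
    by (simp add: enc_Pair)
  then show ?thesis by (metis dec_enc)
qed

lemma enc_Nil: "enc [] = 0"
  by (simp add: enc_list_def)

lemma enc_Cons: "enc (x # xs) = Suc (prod_encode (enc x, enc xs))"
  by (simp add: enc_list_def)

lemma enc_length_le: "length xs \<le> enc xs"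
  by (induction xs) (auto simp: enc_Cons intro: order_trans[OF _ le_prod_encode_2])

section \<open>Closure properties of computable functions and predicates\<close>

definition computable :: "('a::coded \<Rightarrow> 'b::coded) \<Rightarrow> bool" where
  "computable f \<longleftrightarrow> recursive1 (\<lambda>n. enc (f (dec n)))"

definition computable_pred :: "('a::coded \<Rightarrow> bool) \<Rightarrow> bool" where
  "computable_pred P \<longleftrightarrow> computable (\<lambda>x. of_bool (P x) :: nat)"

named_theorems computable_intros

lemma computable_recursive1:
  assumes "recursive1 h" "computable f" "\<And>x. enc (g (f x)) = h (enc (f x))"
  shows "computable (\<lambda>x. g (f x))"
  using recursive_comp1[OF assms(1) assms(2)[unfolded computable_def]]
  unfolding computable_def assms(3) .

lemma computable_recursive2:
  assumes "recursive2 h" "computable f" "computable f'"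
    "\<And>x. enc (g (f x) (f' x)) = h (enc (f x)) (enc (f' x))"
  shows "computable (\<lambda>x. g (f x) (f' x))"
  using recursive_comp2[OF assms(1) assms(2,3)[unfolded computable_def]]
  unfolding computable_def assms(4) .

lemma computable_id [computable_intros]: "computable (\<lambda>x. x)"
  unfolding computable_def by (simp add: recursive_nth)

lemma computable_const [computable_intros]: "computable (\<lambda>_. c)"
  unfolding computable_def by (simp add: recursive_const)

lemma computable_comp:
  assumes "computable f" "computable g"
  shows "computable (\<lambda>x. g (f x))"
  using assms computable_recursive1[of "\<lambda>n. enc (g (dec n))" f g]
  by (simp add: computable_def)

lemma computable_Pair [computable_intros]:
  "computable f \<Longrightarrow> computable g \<Longrightarrow> computable (\<lambda>x. (f x, g x))"
  by (rule computable_recursive2[OF recursive2_prod_encode]) (simp_all add: enc_Pair)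

lemma computable_fst [computable_intros]:
  "computable f \<Longrightarrow> computable (\<lambda>x. fst (f x))"
  by (rule computable_recursive1[OF recursive1_nat_fst]) (simp_all add: enc_prod_def)

lemma computable_snd [computable_intros]:
  "computable f \<Longrightarrow> computable (\<lambda>x. snd (f x))"
  by (rule computable_recursive1[OF recursive1_nat_snd]) (simp_all add: enc_prod_def)

lemma computable_Suc [computable_intros]: "computable f \<Longrightarrow> computable (\<lambda>x. Suc (f x))"
  by (rule computable_recursive1[of Suc]) (auto simp: enc_nat_def intro: recursive_Suc recursive_nth)

lemma computable_nat_ops [computable_intros]:
  fixes f g :: "'a::coded \<Rightarrow> nat"
  assumes "computable f" "computable g"
  shows "computable (\<lambda>x. f x + g x)" "computable (\<lambda>x. f x - g x)" "computable (\<lambda>x. f x * g x)"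
  using assms
  by (auto simp: enc_nat_def intro: computable_recursive2[OF recursive2_add]
      computable_recursive2[OF recursive2_diff] computable_recursive2[OF recursive2_times])

lemma computable_If [computable_intros]:
  assumes P: "computable_pred P" and f: "computable f" and g: "computable g"
  shows "computable (\<lambda>x. if P x then f x else g x)"
proof -
  have "recursive 1 (\<lambda>xs. if of_bool (P (dec (xs ! 0))) = (0::nat) then enc (g (dec (xs ! 0)))
      else enc (f (dec (xs ! 0))))"
    using P f g unfolding computable_pred_def computable_def
    by (intro recursive_comp3[OF recursive3_If]) (simp_all add: enc_nat_def)
  then show ?thesis unfolding computable_def
    by (rule back_subst[of "recursive 1"]) (auto simp: fun_eq_iff)
qed

lemma computable_pred_const [computable_intros]: "computable_pred (\<lambda>_. b)"
  unfolding computable_pred_def by (rule computable_const)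

lemma computable_pred_not [computable_intros]:
  assumes "computable_pred P"
  shows "computable_pred (\<lambda>x. \<not> P x)"
proof -
  have "computable (\<lambda>x. if P x then 0 else 1 :: nat)"
    by (intro computable_intros assms)
  then show ?thesis unfolding computable_pred_def
    by (rule back_subst[of computable]) (auto simp: fun_eq_iff)
qed

lemma computable_pred_If [computable_intros]:
  assumes "computable_pred P" "computable_pred Q" "computable_pred R"
  shows "computable_pred (\<lambda>x. if P x then Q x else R x)"
  using computable_If[OF assms(1) assms(2,3)[unfolded computable_pred_def]]
  unfolding computable_pred_def by (rule back_subst[of computable]) auto

lemma computable_pred_conj [computable_intros]:
  assumes "computable_pred P" "computable_pred Q"
  shows "computable_pred (\<lambda>x. P x \<and> Q x)"
  using computable_pred_If[OF assms computable_pred_const[of False]]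
  by (rule back_subst[of computable_pred]) auto

lemma computable_pred_disj [computable_intros]:
  assumes "computable_pred P" "computable_pred Q"
  shows "computable_pred (\<lambda>x. P x \<or> Q x)"
  using computable_pred_If[OF assms(1) computable_pred_const[of True] assms(2)]
  by (rule back_subst[of computable_pred]) auto

lemma computable_pred_imp [computable_intros]:
  assumes "computable_pred P" "computable_pred Q"
  shows "computable_pred (\<lambda>x. P x \<longrightarrow> Q x)"
  using computable_pred_If[OF assms computable_pred_const[of True]]
  by (rule back_subst[of computable_pred]) auto

lemma computable_pred_comp:
  assumes "computable f" "computable_pred P"
  shows "computable_pred (\<lambda>x. P (f x))"
  using assms computable_comp unfolding computable_pred_def by blast

lemma computable_pred_nat_eq_0 [computable_intros]:
  fixes f :: "'a::coded \<Rightarrow> nat"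
  assumes "computable f"
  shows "computable_pred (\<lambda>x. f x = 0)"
proof -
  have "computable (\<lambda>x. if f x = 0 then 1 else 0 :: nat)"
    by (rule computable_recursive1[OF recursive1_is_zero assms]) (simp add: enc_nat_def)
  then show ?thesis unfolding computable_pred_def of_bool_def .
qed

lemma computable_pred_nat_le [computable_intros]:
  fixes f g :: "'a::coded \<Rightarrow> nat"
  assumes "computable f" "computable g"
  shows "computable_pred (\<lambda>x. f x \<le> g x)"
proof -
  have "computable_pred (\<lambda>x. f x - g x = 0)"
    by (intro computable_intros assms)
  then show ?thesis by simp
qed

lemma computable_enc [computable_intros]: "computable f \<Longrightarrow> computable (\<lambda>x. enc (f x))"
  unfolding computable_def by (simp add: enc_nat_def)

lemma computable_dec [computable_intros]: "computable f \<Longrightarrow> computable (\<lambda>x. dec (f x))"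
  unfolding computable_def by (simp add: enc_nat_def)

lemma computable_pred_eq [computable_intros]:
  assumes "computable f" "computable g"
  shows "computable_pred (\<lambda>x. f x = g x)"
proof -
  have "computable_pred (\<lambda>x. enc (f x) \<le> enc (g x) \<and> enc (g x) \<le> enc (f x))"
    by (intro computable_intros assms)
  then show ?thesis by (simp flip: eq_iff)
qed

lemma computable_rec_nat [computable_intros]:
  assumes n: "computable n" and f: "computable f"
    and g: "computable (\<lambda>z. g (fst z) (fst (snd z)) (snd (snd z)))"
  shows "computable (\<lambda>x. rec_nat (f x) (g x) (n x))"
proof -
  define F where "F m c = enc (rec_nat (f (dec c)) (g (dec c)) m)" for m c
  have "recursive2 F"
  proof (rule recursive2_prim)
    show "recursive1 (\<lambda>c. enc (f (dec c)))"
      using f by (simp add: computable_def)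
    \<comment> \<open>Parameter, counter and accumulator are packed into one number, since
      \<open>g\<close> is computable only as a function of a single coded argument.\<close>
    define G where "G c = enc (case dec c of (x, m, y) \<Rightarrow> g x m y)" for c
    have G: "recursive1 G"
      using g by (simp add: computable_def G_def[abs_def] case_prod_unfold)
    then show "recursive3 (\<lambda>m v c. G (prod_encode (c, prod_encode (m, v))))"
      by (intro recursive_comp1[OF G] recursive_comp2[OF recursive2_prod_encode] recursive_nth) auto
    show "F 0 c = enc (f (dec c))" for c
      by (simp add: F_def)
    show "F (Suc m) c = G (prod_encode (c, prod_encode (m, F m c)))" for m c
    proof -
      have "prod_encode (c, prod_encode (m, F m c))
          = enc (dec c :: 'a, m, rec_nat (f (dec c)) (g (dec c)) m)"
        by (simp add: enc_Pair F_def enc_nat_def)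
      then show ?thesis by (simp add: G_def F_def)
    qed
  qed
  from recursive_comp2[OF this, of 1 "\<lambda>xs. enc (n (dec (xs ! 0)))" "\<lambda>xs. xs ! 0"] n
  show ?thesis by (simp add: computable_def F_def enc_nat_def recursive_nth)
qed

subsection \<open>Lists\<close>

lemma computable_Cons [computable_intros]:
  assumes "computable f" "computable g"
  shows "computable (\<lambda>x. f x # g x)"
proof (rule computable_recursive2[OF _ assms])
  show "recursive2 (\<lambda>m n. Suc (prod_encode (m, n)))"
    by (intro recursive_Suc recursive_comp2[OF recursive2_prod_encode] recursive_nth) auto
qed (simp add: enc_Cons)

text \<open>
  On the empty list \<open>head\<close>, and hence \<open>entry\<close> below out of range, yields the element with code \<open>0\<close>.
  For weights this is \<open>NegInf\<close>, so that vectors and matrices are padded with zeros of the semiring.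
\<close>

definition head :: "'a::coded list \<Rightarrow> 'a" where
  "head xs = (if xs = [] then dec 0 else hd xs)"

lemma head_Cons [simp]: "head (x # xs) = x"
  by (simp add: head_def)

lemma prod_decode_0 [simp]: "prod_decode 0 = (0, 0)"
  by (simp add: prod_decode_def prod_decode_aux.simps)

lemma computable_head [computable_intros]:
  assumes "computable f"
  shows "computable (\<lambda>x. head (f x))"
proof (rule computable_recursive1[OF _ assms])
  show "recursive1 (\<lambda>n. nat_fst (n - 1))"
    by (intro recursive_comp1[OF recursive1_nat_fst] recursive1_pred)
  show "enc (head (f x)) = nat_fst (enc (f x) - 1)" for x
    by (cases "f x") (simp_all add: head_def enc_Nil enc_Cons)
qed

lemma computable_tl [computable_intros]:
  assumes "computable f"
  shows "computable (\<lambda>x. tl (f x))"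
proof (rule computable_recursive1[OF _ assms])
  show "recursive1 (\<lambda>n. nat_snd (n - 1))"
    by (intro recursive_comp1[OF recursive1_nat_snd] recursive1_pred)
  show "enc (tl (f x)) = nat_snd (enc (f x) - 1)" for x
    by (cases "f x") (simp_all add: enc_Nil enc_Cons)
qed

text \<open>A pair with an empty list is a fixed point, so surplus steps do no harm and any upper
  bound on the length may serve as the number of iterations.\<close>

definition fold_step :: "('a::coded \<Rightarrow> 'b \<Rightarrow> 'b) \<Rightarrow> 'a list \<times> 'b \<Rightarrow> 'a list \<times> 'b" where
  "fold_step f z = (if fst z = [] then z else (tl (fst z), f (head (fst z)) (snd z)))"

lemma fold_step_iterate:
  "length xs \<le> n \<Longrightarrow> rec_nat (xs, a) (\<lambda>_. fold_step f) n = ([], fold f xs a)"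
proof -
  have iterate: "rec_nat z (\<lambda>_. fold_step f) n = (fold_step f ^^ n) z" for z
    by (induction n) simp_all
  show "length xs \<le> n \<Longrightarrow> rec_nat (xs, a) (\<lambda>_. fold_step f) n = ([], fold f xs a)"
    unfolding iterate
  proof (induction n arbitrary: xs a)
    case (Suc n)
    show ?case
    proof (cases xs)
      case Nil
      then show ?thesis using Suc.IH[of "[]" a] by (simp add: fold_step_def)
    next
      case (Cons x ys)
      then show ?thesis
        using Suc.IH[of ys "f x a"] Suc.prems
        by (simp add: fold_step_def funpow_swap1[of "fold_step f"] del: funpow.simps(2)
            flip: funpow_Suc_right) (simp add: funpow_Suc_right fold_step_def del: funpow.simps(2))
    qed
  qed simp
qed

lemma computable_fold [computable_intros]:
  assumes "computable xs" "computable a"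
    and g: "computable (\<lambda>z. g (fst z) (fst (snd z)) (snd (snd z)))"
  shows "computable (\<lambda>x. fold (g x) (xs x) (a x))"
proof -
  have g': "computable (\<lambda>z. g (p z) (q z) (r z))"
    if "computable p" "computable q" "computable r" for p :: "'d::coded \<Rightarrow> _" and q r
    using computable_comp[of "\<lambda>z. (p z, q z, r z)", OF _ g] that by (simp add: computable_intros)
  \<comment> \<open>The code of the list serves as the number of iterations; it bounds the length by
    \<open>enc_length_le\<close>.\<close>
  have "computable (\<lambda>x. snd (rec_nat (xs x, a x) (\<lambda>_. fold_step (g x)) (enc (xs x))))"
    unfolding fold_step_def by (intro computable_intros g' assms)
  then show ?thesis by (simp add: fold_step_iterate enc_length_le)
qed

lemma computable_rev [computable_intros]: "computable f \<Longrightarrow> computable (\<lambda>x. rev (f x))"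
  unfolding rev_conv_fold by (intro computable_intros)

lemma computable_append [computable_intros]:
  assumes "computable f" "computable g"
  shows "computable (\<lambda>x. f x @ g x)"
proof -
  have "xs @ ys = fold (#) (rev xs) ys" for xs ys :: "'b list"
    by (simp add: fold_Cons_rev)
  then show ?thesis by (simp only:) (intro computable_intros assms)
qed

lemma computable_map [computable_intros]:
  assumes "computable (\<lambda>z. g (fst z) (snd z))" "computable f"
  shows "computable (\<lambda>x. map (g x) (f x))"
proof -
  have "map h xs = rev (fold (\<lambda>x ys. h x # ys) xs [])" for h :: "'b \<Rightarrow> 'c" and xs
    by (induction xs rule: rev_induct) auto
  moreover have "computable (\<lambda>z. g (fst z) (fst (snd z)))"
    using computable_comp[OF _ assms(1), of "\<lambda>z. (fst z, fst (snd z))"] by (simp add: computable_intros)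
  ultimately show ?thesis by (simp only:) (intro computable_intros assms)
qed

lemma computable_concat [computable_intros]:
  assumes "computable f"
  shows "computable (\<lambda>x. concat (f x))"
proof -
  have "concat xss = fold (\<lambda>xs ys. ys @ xs) xss []" for xss :: "'b list list"
    by (induction xss rule: rev_induct) auto
  then show ?thesis by (simp only:) (intro computable_intros assms)
qed

lemma computable_pred_Ball [computable_intros]:
  assumes "computable_pred (\<lambda>z. P (fst z) (snd z))" "computable f"
  shows "computable_pred (\<lambda>x. \<forall>y\<in>set (f x). P x y)"
proof -
  have "of_bool (\<forall>y\<in>set xs. Q y) = fold (\<lambda>y b. if Q y then b else 0) xs (1 :: nat)"
    for Q :: "'b \<Rightarrow> bool" and xs
    by (induction xs rule: rev_induct) auto
  moreover have "computable_pred (\<lambda>z. P (fst z) (fst (snd z)))"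
    using computable_pred_comp[OF _ assms(1), of "\<lambda>z. (fst z, fst (snd z))"]
    by (simp add: computable_intros)
  ultimately show ?thesis unfolding computable_pred_def[of "\<lambda>x. \<forall>y\<in>set (f x). P x y"]
    by (simp only:) (intro computable_intros assms)
qed

lemma computable_pred_Bex [computable_intros]:
  assumes "computable_pred (\<lambda>z. P (fst z) (snd z))" "computable f"
  shows "computable_pred (\<lambda>x. \<exists>y\<in>set (f x). P x y)"
proof -
  have "computable_pred (\<lambda>x. \<not> (\<forall>y\<in>set (f x). \<not> P x y))"
    by (intro computable_intros assms)
  then show ?thesis by simp
qed

lemma computable_upt [computable_intros]:
  assumes "computable n"
  shows "computable (\<lambda>x. [0..<n x])"
proof -
  have "[0..<m] = rec_nat [] (\<lambda>i is. is @ [i]) m" for m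
    by (induction m) auto
  then show ?thesis by (simp only:) (intro computable_intros assms)
qed

definition entry :: "'a::coded list \<Rightarrow> nat \<Rightarrow> 'a" where
  "entry xs i = head (drop i xs)"

lemma computable_entry [computable_intros]:
  assumes "computable f" "computable n"
  shows "computable (\<lambda>x. entry (f x) (n x))"
proof -
  have "drop i xs = rec_nat xs (\<lambda>_ ys. tl ys) i" for i and xs :: "'b list"
    by (induction i) (auto simp: drop_Suc drop_tl)
  then show ?thesis unfolding entry_def by (simp only:) (intro computable_intros assms)
qed

lemma entry_eq: "entry xs i = (if i < length xs then xs ! i else dec 0)"
  by (auto simp: entry_def head_def hd_drop_conv_nth)

subsection \<open>Integers and weights\<close>

text \<open>The codes \<open>0, 1, 2, 3, 4, \<dots>\<close> stand for the integers \<open>0, -1, 1, -2, 2, \<dots>\<close>.\<close>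

lemma nat_parts_eq:
  "(nat i, nat (- i)) = rec_nat (0, 0)
    (\<lambda>_ z. if snd z = 0 then (0, Suc (fst z)) else (snd z, 0)) (enc i)"
proof -
  define step :: "nat \<Rightarrow> nat \<times> nat \<Rightarrow> nat \<times> nat"
    where "step = (\<lambda>_ z. if snd z = 0 then (0, Suc (fst z)) else (snd z, 0))"
  have "rec_nat (0, 0) step (2 * m) = (m, 0) \<and> rec_nat (0, 0) step (Suc (2 * m)) = (0, Suc m)" for m
    by (induction m) (auto simp: step_def)
  then have "rec_nat (0, 0) step (2 * m) = (m, 0)" "rec_nat (0, 0) step (Suc (2 * m)) = (0, Suc m)" for m
    by blast+
  note steps = this
  have "(nat i, nat (- i)) = rec_nat (0, 0) step (enc i)"
  proof (cases "0 \<le> i")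
    case True
    then show ?thesis using steps(1)[of "nat i"] by (simp add: enc_int_def int_encode_def sum_encode_def)
  next
    case False
    then have "nat (- i) = Suc (nat (- i - 1))" "nat i = 0" by auto
    with False show ?thesis
      by (simp only: steps enc_int_def int_encode_def sum_encode_def if_False sum.case)
  qed
  then show ?thesis by (simp add: step_def)
qed

lemma computable_nat_parts [computable_intros]:
  assumes "computable f"
  shows "computable (\<lambda>x. nat (f x))" "computable (\<lambda>x. nat (- f x))"
proof -
  have "computable (\<lambda>x. (nat (f x), nat (- f x)))"
    unfolding nat_parts_eq by (intro computable_intros assms)
  from computable_fst[OF this] computable_snd[OF this]
  show "computable (\<lambda>x. nat (f x))" "computable (\<lambda>x. nat (- f x))" by simp_all
qed

lemma computable_int_diff:
  fixes f g :: "'a::coded \<Rightarrow> nat"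
  assumes "computable f" "computable g"
  shows "computable (\<lambda>x. int (f x) - int (g x))"
proof -
  have eq: "int a - int b = dec (if b \<le> a then 2 * (a - b) else 2 * (b - a) - 1)" for a b
  proof -
    have "enc (int a - int b) = (if b \<le> a then 2 * (a - b) else 2 * (b - a) - 1)"
      by (auto simp: enc_int_def int_encode_def sum_encode_def nat_diff_distrib)
    then show ?thesis by (metis dec_enc)
  qed
  show ?thesis unfolding eq by (intro computable_intros assms)
qed

lemma computable_int [computable_intros]:
  fixes f :: "'a::coded \<Rightarrow> nat"
  shows "computable f \<Longrightarrow> computable (\<lambda>x. int (f x))"
  using computable_int_diff[OF _ computable_const[of 0]] by fastforce

lemma computable_int_ops [computable_intros]:
  fixes f g :: "'a::coded \<Rightarrow> int"
  assumes "computable f" "computable g"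
  shows "computable (\<lambda>x. f x + g x)" "computable (\<lambda>x. f x - g x)"
    "computable_pred (\<lambda>x. f x \<le> g x)" "computable_pred (\<lambda>x. f x < g x)"
proof -
  have add: "i + j = int (nat i + nat j) - int (nat (- i) + nat (- j))"
    and diff: "i - j = int (nat i + nat (- j)) - int (nat (- i) + nat j)"
    and le: "i \<le> j \<longleftrightarrow> nat i + nat (- j) \<le> nat (- i) + nat j"
    and less: "i < j \<longleftrightarrow> \<not> nat (- i) + nat j \<le> nat i + nat (- j)" for i j
    by auto
  show "computable (\<lambda>x. f x + g x)" unfolding add
    by (intro computable_int_diff computable_intros assms)
  have "computable (\<lambda>x. int (nat (f x) + nat (- g x)) - int (nat (- f x) + nat (g x)))"
    by (intro computable_int_diff computable_intros assms)
  then show "computable (\<lambda>x. f x - g x)" by (simp only: diff[symmetric])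
  show "computable_pred (\<lambda>x. f x \<le> g x)" unfolding le by (intro computable_intros assms)
  show "computable_pred (\<lambda>x. f x < g x)" unfolding less by (intro computable_intros assms)
qed

lemma computable_uminus [computable_intros]:
  fixes f :: "'a::coded \<Rightarrow> int"
  shows "computable f \<Longrightarrow> computable (\<lambda>x. - f x)"
  using computable_int_ops(2)[OF computable_const[of 0]] by fastforce

definition weight :: "zmax \<Rightarrow> int" where
  "weight x = (case x of NegInf \<Rightarrow> 0 | Fin a \<Rightarrow> a)"

lemma weight_Fin [simp]: "weight (Fin a) = a"
  by (simp add: weight_def)

lemma computable_weight [computable_intros]:
  assumes "computable f"
  shows "computable (\<lambda>x. weight (f x))"
proof -
  \<comment> \<open>The default 0 at \<open>NegInf\<close> is the integer with code 0, which is also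
    what truncated subtraction yields on the code of \<open>NegInf\<close>.\<close>
  have "weight y = dec (enc y - 1)" for y
  proof (cases y)
    case NegInf
    have "enc (0 :: int) = 0" by (simp add: enc_int_def int_encode_def sum_encode_def)
    with NegInf show ?thesis by (metis weight_def zmax.case(1) enc_zmax_def code_zmax.simps(1) diff_0_eq_0 dec_enc)
  next
    case (Fin a)
    then have "enc y - 1 = enc a" by (simp add: enc_zmax_def enc_int_def)
    with Fin show ?thesis by (simp only: dec_enc weight_Fin)
  qed
  then show ?thesis by (simp only:) (intro computable_intros assms)
qed

lemma computable_Fin [computable_intros]:
  assumes "computable f"
  shows "computable (\<lambda>x. Fin (f x))"
proof -
  have "Fin a = dec (Suc (enc a))" for a
    by (metis dec_enc enc_zmax_def enc_int_def code_zmax.simps(2))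
  then show ?thesis by (simp only:) (intro computable_intros assms)
qed

lemma computable_zmax_ops [computable_intros]:
  fixes f g :: "'a::coded \<Rightarrow> zmax"
  assumes "computable f" "computable g"
  shows "computable (\<lambda>x. f x * g x)" "computable (\<lambda>x. f x + g x)"
    "computable_pred (\<lambda>x. f x \<le> g x)" "computable_pred (\<lambda>x. f x < g x)"
proof -
  have times: "x * y = (if x = NegInf \<or> y = NegInf then NegInf else Fin (weight x + weight y))"
    for x y :: zmax by (cases x; cases y) auto
  have le: "x \<le> y \<longleftrightarrow> x = NegInf \<or> y \<noteq> NegInf \<and> weight x \<le> weight y"
    for x y :: zmax by (cases x; cases y) auto
  show "computable (\<lambda>x. f x * g x)"
    unfolding times by (intro computable_intros assms)
  show le': "computable_pred (\<lambda>x. f x \<le> g x)"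
    unfolding le by (intro computable_intros assms)
  show "computable (\<lambda>x. f x + g x)"
    unfolding plus_zmax_def max_def by (intro computable_intros le' assms)
  show "computable_pred (\<lambda>x. f x < g x)"
    unfolding not_le[symmetric] le by (intro computable_intros assms)
qed

subsection \<open>Unbounded search\<close>

text \<open>\<open>Mu\<close> looks for the value 0 and places the candidate before the arguments;
  hence the negation and the swapped pair in the proof. The existence of solutions makes the search
  total.\<close>

lemma computable_Least:
  fixes P :: "'a::coded \<Rightarrow> nat \<Rightarrow> bool"
  assumes P: "computable_pred (\<lambda>z. P (fst z) (snd z))" and ex: "\<And>x. \<exists>n. P x n"
  shows "computable (\<lambda>x. LEAST n. P x n)"
proof -
  have "computable_pred (\<lambda>z :: nat \<times> nat. \<not> P (dec (snd z)) (fst z))"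
    using computable_pred_comp[OF _ P, of "\<lambda>z :: nat \<times> nat. (dec (snd z), fst z)"]
    by (simp add: computable_intros)
  then have "recursive1 (\<lambda>c. enc (of_bool (\<not> P (dec (nat_snd c)) (nat_fst c)) :: nat))"
    unfolding computable_pred_def computable_def
    by (rule back_subst[of recursive1]) (simp add: dec_prod dec_nat)
  from recursive_comp1[OF this recursive_comp2[OF recursive2_prod_encode recursive_nth recursive_nth], of 0 2 1]
  have "recursive2 (\<lambda>n c. of_bool (\<not> P (dec c) n))"
    by (simp add: enc_nat_def)
  then obtain p where "\<And>xs. length xs = 2 \<Longrightarrow> computes p xs (of_bool (\<not> P (dec (xs ! 1)) (xs ! 0)))"
    unfolding recursive_def by blast
  from this[of "[_, _]"] have p: "computes p [n, c] (of_bool (\<not> P (dec c) n))" for n c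
    by simp
  have "computes (Mu p) [c] (LEAST n. P (dec c) n)" for c
  proof (rule computes.Mu)
    have "P (dec c) (LEAST n. P (dec c) n)" using ex by (rule LeastI_ex)
    then show "computes p [LEAST n. P (dec c) n, c] 0"
      using p[of "LEAST n. P (dec c) n" c] by simp
    show "\<forall>m<LEAST n. P (dec c) n. \<exists>y. computes p [m, c] (Suc y)"
      using p[of _ c] not_less_Least by (metis One_nat_def of_bool_eq(2))
  qed
  then have "computes (Mu p) xs (LEAST n. P (dec (xs ! 0)) n)" if "length xs = 1" for xs
    using that by (cases xs) auto
  then show ?thesis unfolding computable_def recursive_def enc_nat_def by blast
qed

text \<open>Post's theorem: exactly one of the two searches can succeed, so the kind of the witness
  found first is the answer.\<close>

theorem computable_pred_by_search:
  fixes P :: "'a::coded \<Rightarrow> bool" and R :: "'a \<Rightarrow> nat \<Rightarrow> bool" and S :: "'a \<Rightarrow> 'b::coded \<Rightarrow> bool"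
  assumes R: "computable_pred (\<lambda>z. R (fst z) (snd z))" and S: "computable_pred (\<lambda>z. S (fst z) (snd z))"
    and P: "\<And>x. P x \<longleftrightarrow> (\<exists>c. S x c)" and not_P: "\<And>x. \<not> P x \<longleftrightarrow> (\<exists>n. R x n)"
  shows "computable_pred P"
proof -
  \<comment> \<open>One counter drives both searches: \<open>n\<close> is the index for
    \<open>R\<close> and, through \<open>dec\<close>, the candidate for \<open>S\<close>.\<close>
  define T where "T x n \<longleftrightarrow> R x n \<or> S x (dec n)" for x n
  have S': "computable_pred (\<lambda>z :: 'a \<times> nat. S (fst z) (dec (snd z)))"
    using computable_pred_comp[OF _ S, of "\<lambda>z :: 'a \<times> nat. (fst z, dec (snd z))"]
    by (simp add: computable_intros)
  have "computable (\<lambda>x. LEAST n. T x n)"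
  proof (rule computable_Least)
    show "computable_pred (\<lambda>z. T (fst z) (snd z))"
      unfolding T_def by (intro computable_intros R S')
    show "\<exists>n. T x n" for x
      using P[of x] not_P[of x] unfolding T_def by (metis dec_enc)
  qed
  then have "computable (\<lambda>x. (x, LEAST n. T x n))"
    by (intro computable_intros)
  from computable_pred_comp[OF this computable_pred_not[OF R]]
  have "computable_pred (\<lambda>x. \<not> R x (LEAST n. T x n))" by simp
  moreover have "\<not> R x (LEAST n. T x n) \<longleftrightarrow> P x" for x
    using LeastI_ex[of "T x"] P[of x] not_P[of x] unfolding T_def by (metis dec_enc)
  ultimately show ?thesis by simp
qed

section \<open>Weighted one-counter systems\<close>

lemma zmax_plus_simps [simp]:
  "NegInf + x = x" "x + NegInf = x" "Fin a + Fin b = Fin (max a b)"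
  by (cases x; auto simp: plus_zmax_def max_def)+

lemma zmax_times_NegInf [simp]: "x * NegInf = NegInf"
  by (cases x) auto

lemma zmax_order_simps [simp]:
  "x \<le> NegInf \<longleftrightarrow> x = NegInf" "Fin a < Fin b \<longleftrightarrow> a < b" "NegInf < x \<longleftrightarrow> x \<noteq> NegInf" "\<not> x < NegInf"
  by (cases x; auto simp: less_zmax_def)+

lemma zmax_times_eq_NegInf [simp]: "x * y = NegInf \<longleftrightarrow> x = NegInf \<or> y = NegInf"
  by (cases x; cases y) auto

lemma zmax_times_mono: "x \<le> x' \<Longrightarrow> y \<le> y' \<Longrightarrow> x * y \<le> x' * (y' :: zmax)"
  by (cases x; cases x'; cases y; cases y') auto

lemma zmax_Fin_times_le_iff [simp]: "Fin a * x \<le> Fin a * y \<longleftrightarrow> x \<le> y"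
  by (cases x; cases y) auto

type_synonym 'p edge = "'p \<times> 'p \<times> zmax \<times> zmax \<times> zmax \<times> zmax"

text \<open>
  An edge \<open>(p, q, a, b, c, d)\<close> multiplies the row vector \<open>(u, l)\<close> by the matrix with rows \<open>(a, b)\<close> and
  \<open>(c, d)\<close>.  Only vectors with \<open>l \<le> u\<close> are kept: the state records which component comes first.
\<close>

inductive reach :: "'p edge set \<Rightarrow> 'p \<Rightarrow> 'p \<Rightarrow> zmax \<Rightarrow> zmax \<Rightarrow> bool" for E s where
  start: "reach E s s (Fin 0) NegInf"
| step: "reach E s p u l \<Longrightarrow> (p, q, a, b, c, d) \<in> E \<Longrightarrow> u * b + l * d \<le> u * a + l * c \<Longrightarrow>
    reach E s q (u * a + l * c) (u * b + l * d)"

lemma reach_le: "reach E s p u l \<Longrightarrow> l \<le> u"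
  by (induction rule: reach.induct) auto

text \<open>The max-plus quotient of \<open>f\<close> by \<open>e\<close>, wanted only for finite
  \<open>e\<close>: dividing the vector (e, f) by its first component leaves (Fin 0, gap e
  f).\<close>

definition gap :: "zmax \<Rightarrow> zmax \<Rightarrow> zmax" where
  "gap e f = (if f = NegInf then NegInf else Fin (weight f - weight e))"

text \<open>A missing key and an entry \<open>NegInf\<close> are opposites: the former covers no
  value, the latter covers all of them. Covering thus also asserts that the key is present.\<close>

definition covers :: "('k \<times> zmax) list \<Rightarrow> 'k \<Rightarrow> zmax \<Rightarrow> bool" where
  "covers L k v \<longleftrightarrow> (\<exists>(k', v')\<in>set L. k' = k \<and> v' \<le> v)"

lemma covers_mono: "covers L k v \<Longrightarrow> v \<le> v' \<Longrightarrow> covers L k v'"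
  unfolding covers_def by (blast intro: order_trans)

lemma coversE:
  assumes "covers L k v"
  obtains v' where "(k, v') \<in> set L" "v' \<le> v"
  using assms unfolding covers_def by blast

definition small_differences :: "int \<Rightarrow> 'p edge \<Rightarrow> bool" where
  "small_differences N = (\<lambda>(p, q, a, b, c, d). \<forall>x\<in>set [a, b, c, d]. \<forall>y\<in>set [a, b, c, d].
     x \<noteq> NegInf \<longrightarrow> y \<noteq> NegInf \<longrightarrow> weight x - weight y < N)"

text \<open>If \<open>u - l\<close> is at least \<open>N\<close>, then \<open>u * a\<close> beats
  \<open>l * c\<close>, and \<open>b = NegInf\<close> leaves \<open>l * d\<close> as the second
  component. So these are the edges that keep both components and change the difference by
  \<open>weight a - weight d\<close>.\<close>

definition shift_edge :: "zmax \<Rightarrow> zmax \<Rightarrow> zmax \<Rightarrow> bool" where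
  "shift_edge a b d \<longleftrightarrow> a \<noteq> NegInf \<and> b = NegInf \<and> d \<noteq> NegInf"

lemma small_differencesD:
  assumes "small_differences N (p, q, a, b, c, d)" "x \<in> {a, b, c, d}" "y \<in> {a, b, c, d}"
    "x \<noteq> NegInf" "y \<noteq> NegInf"
  shows "weight x - weight y < N"
proof -
  from assms(1)[unfolded small_differences_def case_prod_conv list.set]
  have "\<forall>x\<in>{a, b, c, d}. \<forall>y\<in>{a, b, c, d}.
     x \<noteq> NegInf \<longrightarrow> y \<noteq> NegInf \<longrightarrow> weight x - weight y < N" .
  with assms(2-) show ?thesis by (metis (no_types))
qed

lemma shift_edge_weights:
  assumes "small_differences N (p, q, a, b, c, d)" "shift_edge a b d"
  obtains x y where "a = Fin x" "b = NegInf" "d = Fin y" "x - y < N" "y - x < N"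
    "\<And>z. c = Fin z \<Longrightarrow> z - x < N"
proof -
  obtain x y where xy: "a = Fin x" "b = NegInf" "d = Fin y"
    using assms(2) unfolding shift_edge_def by (cases a; cases d) auto
  note small = small_differencesD[OF assms(1)]
  from small[of a d] small[of d a] small[of c a] xy
  show thesis by (intro that[OF xy]) auto
qed

type_synonym 'p certificate = "int \<times> 'p list \<times> (('p \<times> zmax) \<times> zmax) list \<times>
  (('p \<times> int) \<times> zmax) list \<times> (('p \<times> int) \<times> zmax) list \<times>
  ((('p \<times> int) \<times> ('p \<times> int)) \<times> zmax) list"

text \<open>
  A vector \<open>(u, l)\<close> whose difference \<open>u - l\<close> is \<open>N * j + r\<close> with \<open>0 \<le> r < N\<close> is on level \<open>j\<close> with
  residue \<open>r\<close>.  A certificate consists of lower bounds, where \<open>NegInf\<close> means that there is none and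
  where keys that cannot occur have no entry: \<open>base\<close> bounds \<open>u\<close> for a given difference \<open>l - u\<close> above
  \<open>- 2 * N\<close> or infinite; \<open>upper\<close> bounds \<open>u\<close> and \<open>lower\<close> bounds \<open>l\<close> on the positive levels; \<open>exc\<close>
  bounds the increase of \<open>u\<close> along excursions that start and end on the same positive level and stay
  on or above it.  The list \<open>dead\<close> contains the states that can be reached with \<open>(NegInf, NegInf)\<close>.
\<close>

definition certifies :: "'p edge list \<Rightarrow> 'p \<Rightarrow> 'p \<Rightarrow> 'p certificate \<Rightarrow> bool" where
  "certifies Es s t = (\<lambda>(N, dead, base, upper, lower, exc).
     0 < N \<and>
     (\<forall>x\<in>set Es. small_differences N x) \<and>
     covers base (s, NegInf) (Fin 0) \<and>
     (\<forall>((p, g), v)\<in>set base. \<forall>(p', q, a, b, c, d)\<in>set Es.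
        p' = p \<and> b + g * d \<le> a + g * c \<longrightarrow>
        (if a + g * c = NegInf then \<exists>q'\<in>set dead. q' = q
         else b + g * d = NegInf \<or> weight (a + g * c) - weight (b + g * d) < N + N \<longrightarrow>
           covers base (q, gap (a + g * c) (b + g * d)) (v * (a + g * c)))) \<and>
     (\<forall>p\<in>set dead. \<forall>(p', q, a, b, c, d)\<in>set Es. p' = p \<longrightarrow> (\<exists>q'\<in>set dead. q' = q)) \<and>
     (\<forall>(p, q, a, b, c, d)\<in>set Es. \<forall>r\<in>set (map int [0..<nat N]).
        covers exc ((p, r), (p, r)) (Fin 0) \<and> covers exc ((q, r), (q, r)) (Fin 0)) \<and>
     (\<forall>((x, (p, r)), v)\<in>set exc. \<forall>(p', q, a, b, c, d)\<in>set Es.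
        p' = p \<and> shift_edge a b d \<longrightarrow>
        (0 \<le> r + (weight a - weight d) \<and> r + (weight a - weight d) < N \<longrightarrow>
           covers exc (x, (q, r + (weight a - weight d))) (v * a)) \<and>
        (N \<le> r + (weight a - weight d) \<longrightarrow>
           (\<forall>((y, (p2, r2)), v')\<in>set exc. \<forall>(p2', q2, a', b', c', d')\<in>set Es.
              y = (q, r + (weight a - weight d) - N) \<and> p2' = p2 \<and> shift_edge a' b' d' \<and>
              r2 + (weight a' - weight d') < 0 \<longrightarrow>
              covers exc (x, (q2, r2 + (weight a' - weight d') + N)) (v * a * v' * a')))) \<and>
     (\<forall>((p, g), v)\<in>set base. \<forall>(((p', r), (q, r')), v')\<in>set exc.
        p' = p \<and> g = Fin (- N - r) \<longrightarrow> covers base (q, Fin (- N - r')) (v * v')) \<and>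
     (\<forall>((p, g), v)\<in>set base. g \<noteq> NegInf \<and> weight g \<le> - N \<longrightarrow>
        covers upper (p, - weight g - N) v \<and> covers lower (p, - weight g - N) (v * g)) \<and>
     (\<forall>(x, v)\<in>set upper. \<forall>((x', y), v')\<in>set exc. x' = x \<longrightarrow> covers upper y (v * v')) \<and>
     (\<forall>((p, r), v)\<in>set lower. \<forall>((x', (q, r')), v')\<in>set exc.
        x' = (p, r) \<longrightarrow> covers lower (q, r') (v * v' * Fin (r - r'))) \<and>
     (\<forall>((p, r), v)\<in>set upper. \<forall>(p', q, a, b, c, d)\<in>set Es. p' = p \<longrightarrow>
        (shift_edge a b d \<and> N \<le> r + (weight a - weight d) \<longrightarrow>
           covers upper (q, r + (weight a - weight d) - N) (v * a)) \<and>
        (a \<noteq> NegInf \<and> (b \<noteq> NegInf \<or> d = NegInf) \<and> b \<le> a \<longrightarrow>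
           covers base (q, gap a b) (v * a))) \<and>
     (\<forall>((p, r), v)\<in>set lower. \<forall>(p', q, a, b, c, d)\<in>set Es. p' = p \<longrightarrow>
        (shift_edge a b d \<and> N \<le> r + (weight a - weight d) \<longrightarrow>
           covers lower (q, r + (weight a - weight d) - N) (v * d)) \<and>
        (a = NegInf \<and> b = NegInf \<and> d \<le> c \<longrightarrow>
           (if c = NegInf then \<exists>q'\<in>set dead. q' = q else covers base (q, gap c d) (v * c)))) \<and>
     (\<forall>p\<in>set dead. p \<noteq> t) \<and>
     (\<forall>((p, g), v)\<in>set base. p = t \<longrightarrow> Fin 0 \<le> v) \<and>
     (\<forall>((p, r), v)\<in>set upper. p = t \<longrightarrow> Fin 0 \<le> v))"

subsection \<open>Soundness of certificates\<close>

locale certificate =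
  fixes Es :: "'p edge list" and s t :: 'p and N :: int and dead base upper lower exc
  assumes ok: "certifies Es s t (N, dead, base, upper, lower, exc)"
begin

lemma N_pos: "0 < N"
  using ok unfolding certifies_def case_prod_conv by (elim conjE)

lemma small_differences: "x \<in> set Es \<Longrightarrow> small_differences N x"
proof -
  have "\<forall>x\<in>set Es. small_differences N x"
    using ok unfolding certifies_def case_prod_conv by (elim conjE)
  then show "x \<in> set Es \<Longrightarrow> small_differences N x" by blast
qed

lemmas small = small_differencesD[OF small_differences]

lemmas edge_weights = shift_edge_weights[OF small_differences]

lemma base_start: "covers base (s, NegInf) (Fin 0)"
  using ok unfolding certifies_def case_prod_conv by (elim conjE)

lemma base_step:
  assumes "covers base (p, g) v" "(p, q, a, b, c, d) \<in> set Es" "b + g * d \<le> a + g * c"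
  shows "a + g * c = NegInf \<Longrightarrow> q \<in> set dead"
    and "a + g * c \<noteq> NegInf \<Longrightarrow>
      b + g * d = NegInf \<or> weight (a + g * c) - weight (b + g * d) < N + N \<Longrightarrow>
      covers base (q, gap (a + g * c) (b + g * d)) (v * (a + g * c))"
proof -
  obtain v' where v': "((p, g), v') \<in> set base" "v' \<le> v"
    using assms(1) by (rule coversE)
  have *: "\<forall>((p, g), v)\<in>set base. \<forall>(p', q, a, b, c, d)\<in>set Es.
        p' = p \<and> b + g * d \<le> a + g * c \<longrightarrow>
        (if a + g * c = NegInf then \<exists>q'\<in>set dead. q' = q
         else b + g * d = NegInf \<or> weight (a + g * c) - weight (b + g * d) < N + N \<longrightarrow>
           covers base (q, gap (a + g * c) (b + g * d)) (v * (a + g * c)))"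
    using ok unfolding certifies_def case_prod_conv by (elim conjE)
  note step = bspec[OF bspec[OF this v'(1), unfolded case_prod_conv] assms(2), unfolded case_prod_conv]
  show "a + g * c = NegInf \<Longrightarrow> q \<in> set dead" using step assms(3) by auto
  assume "a + g * c \<noteq> NegInf"
    "b + g * d = NegInf \<or> weight (a + g * c) - weight (b + g * d) < N + N"
  then have "covers base (q, gap (a + g * c) (b + g * d)) (v' * (a + g * c))"
    using step assms(3) by simp
  then show "covers base (q, gap (a + g * c) (b + g * d)) (v * (a + g * c))"
    by (rule covers_mono) (intro zmax_times_mono v' order_refl)
qed

lemma dead_step: "p \<in> set dead \<Longrightarrow> (p, q, a, b, c, d) \<in> set Es \<Longrightarrow> q \<in> set dead"
proof -
  have "\<forall>p\<in>set dead. \<forall>(p', q, a, b, c, d)\<in>set Es. p' = p \<longrightarrow> (\<exists>q'\<in>set dead. q' = q)"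
    using ok unfolding certifies_def case_prod_conv by (elim conjE)
  then show "p \<in> set dead \<Longrightarrow> (p, q, a, b, c, d) \<in> set Es \<Longrightarrow> q \<in> set dead" by blast
qed

lemma exc_refl:
  assumes "(p, q, a, b, c, d) \<in> set Es" "0 \<le> r" "r < N"
  shows "covers exc ((p, r), (p, r)) (Fin 0)" "covers exc ((q, r), (q, r)) (Fin 0)"
proof -
  have "\<forall>(p, q, a, b, c, d)\<in>set Es. \<forall>r\<in>set (map int [0..<nat N]).
        covers exc ((p, r), (p, r)) (Fin 0) \<and> covers exc ((q, r), (q, r)) (Fin 0)"
    using ok unfolding certifies_def case_prod_conv by (elim conjE)
  moreover have "r \<in> set (map int [0..<nat N])"
    using assms(2,3) by (auto intro!: image_eqI[of _ _ "nat r"])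
  ultimately show "covers exc ((p, r), (p, r)) (Fin 0)" "covers exc ((q, r), (q, r)) (Fin 0)"
    using assms(1) by blast+
qed

lemma exc_rules:
  "\<forall>((x, (p, r)), v)\<in>set exc. \<forall>(p', q, a, b, c, d)\<in>set Es.
        p' = p \<and> shift_edge a b d \<longrightarrow>
        (0 \<le> r + (weight a - weight d) \<and> r + (weight a - weight d) < N \<longrightarrow>
           covers exc (x, (q, r + (weight a - weight d))) (v * a)) \<and>
        (N \<le> r + (weight a - weight d) \<longrightarrow>
           (\<forall>((y, (p2, r2)), v')\<in>set exc. \<forall>(p2', q2, a', b', c', d')\<in>set Es.
              y = (q, r + (weight a - weight d) - N) \<and> p2' = p2 \<and> shift_edge a' b' d' \<and>
              r2 + (weight a' - weight d') < 0 \<longrightarrow>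
              covers exc (x, (q2, r2 + (weight a' - weight d') + N)) (v * a * v' * a')))"
  using ok unfolding certifies_def case_prod_conv by (elim conjE)

lemma exc_step:
  assumes "covers exc (x, (p, r)) v" "(p, q, a, b, c, d) \<in> set Es" "shift_edge a b d"
    "0 \<le> r + (weight a - weight d)" "r + (weight a - weight d) < N"
  shows "covers exc (x, (q, r + (weight a - weight d))) (v * a)"
proof -
  obtain v' where v': "((x, (p, r)), v') \<in> set exc" "v' \<le> v"
    using assms(1) by (rule coversE)
  have "covers exc (x, (q, r + (weight a - weight d))) (v' * a)"
    using bspec[OF bspec[OF exc_rules v'(1), unfolded case_prod_conv] assms(2), unfolded case_prod_conv]
      assms(3-5) by blast
  then show ?thesis by (rule covers_mono) (intro zmax_times_mono v' order_refl)
qed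

lemma exc_up_down:
  assumes "covers exc (x, (p, r)) v" "(p, q, a, b, c, d) \<in> set Es" "shift_edge a b d"
    "N \<le> r + (weight a - weight d)"
    "covers exc ((q, r + (weight a - weight d) - N), (p2, r2)) v2"
    "(p2, q2, a', b', c', d') \<in> set Es" "shift_edge a' b' d'"
    "r2 + (weight a' - weight d') < 0"
  shows "covers exc (x, (q2, r2 + (weight a' - weight d') + N)) (v * a * v2 * a')"
proof -
  obtain v' where v': "((x, (p, r)), v') \<in> set exc" "v' \<le> v"
    using assms(1) by (rule coversE)
  obtain v2' where v2': "((((q, r + (weight a - weight d) - N)), (p2, r2)), v2') \<in> set exc" "v2' \<le> v2"
    using assms(5) by (rule coversE)
  from mp[OF conjunct2[OF mp[OF bspec[OF bspec[OF exc_rules v'(1), unfolded case_prod_conv]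
          assms(2), unfolded case_prod_conv] conjI[OF refl assms(3)]]] assms(4)]
  have "\<forall>((y, (p2, r2)), v2)\<in>set exc. \<forall>(p2', q2, a', b', c', d')\<in>set Es.
              y = (q, r + (weight a - weight d) - N) \<and> p2' = p2 \<and> shift_edge a' b' d' \<and>
              r2 + (weight a' - weight d') < 0 \<longrightarrow>
              covers exc (x, (q2, r2 + (weight a' - weight d') + N)) (v' * a * v2 * a')" .
  from bspec[OF bspec[OF this v2'(1), unfolded case_prod_conv] assms(6), unfolded case_prod_conv]
  have "covers exc (x, (q2, r2 + (weight a' - weight d') + N)) (v' * a * v2' * a')"
    using assms(7,8) by blast
  then show ?thesis by (rule covers_mono) (intro zmax_times_mono v' v2' order_refl)
qed

lemma base_exc:
  assumes "covers base (p, Fin (- N - r)) v" "covers exc ((p, r), (q, r')) w"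
  shows "covers base (q, Fin (- N - r')) (v * w)"
proof -
  obtain v' w' where v': "((p, Fin (- N - r)), v') \<in> set base" "v' \<le> v"
    and w': "(((p, r), (q, r')), w') \<in> set exc" "w' \<le> w"
    using assms by (meson coversE)
  have "\<forall>((p, g), v)\<in>set base. \<forall>(((p', r), (q, r')), v')\<in>set exc.
        p' = p \<and> g = Fin (- N - r) \<longrightarrow> covers base (q, Fin (- N - r')) (v * v')"
    using ok unfolding certifies_def case_prod_conv by (elim conjE)
  from bspec[OF bspec[OF this v'(1), unfolded case_prod_conv] w'(1), unfolded case_prod_conv]
  have "covers base (q, Fin (- N - r')) (v' * w')" by blast
  then show ?thesis by (rule covers_mono) (intro zmax_times_mono v' w')
qed

lemma base_upper_lower:
  assumes "covers base (p, Fin (- N - r)) v" "0 \<le> r"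
  shows "covers upper (p, r) v" "covers lower (p, r) (v * Fin (- N - r))"
proof -
  obtain v' where v': "((p, Fin (- N - r)), v') \<in> set base" "v' \<le> v"
    using assms(1) by (rule coversE)
  have "\<forall>((p, g), v)\<in>set base. g \<noteq> NegInf \<and> weight g \<le> - N \<longrightarrow>
        covers upper (p, - weight g - N) v \<and> covers lower (p, - weight g - N) (v * g)"
    using ok unfolding certifies_def case_prod_conv by (elim conjE)
  from bspec[OF this v'(1), unfolded case_prod_conv] assms(2)
  have "covers upper (p, r) v'" "covers lower (p, r) (v' * Fin (- N - r))" by simp_all
  then show "covers upper (p, r) v" "covers lower (p, r) (v * Fin (- N - r))"
    using v'(2) by (auto intro: covers_mono zmax_times_mono)
qed

lemma upper_exc:
  assumes "covers upper x v" "covers exc (x, y) w"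
  shows "covers upper y (v * w)"
proof -
  obtain v' w' where v': "(x, v') \<in> set upper" "v' \<le> v" and w': "((x, y), w') \<in> set exc" "w' \<le> w"
    using assms by (meson coversE)
  have "\<forall>(x, v)\<in>set upper. \<forall>((x', y), v')\<in>set exc. x' = x \<longrightarrow> covers upper y (v * v')"
    using ok unfolding certifies_def case_prod_conv by (elim conjE)
  from bspec[OF bspec[OF this v'(1), unfolded case_prod_conv] w'(1), unfolded case_prod_conv]
  have "covers upper y (v' * w')" by blast
  then show ?thesis by (rule covers_mono) (intro zmax_times_mono v' w')
qed

lemma lower_exc:
  assumes "covers lower (p, r) v" "covers exc ((p, r), (q, r')) w"
  shows "covers lower (q, r') (v * w * Fin (r - r'))"
proof -
  obtain v' w' where v': "((p, r), v') \<in> set lower" "v' \<le> v"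
    and w': "(((p, r), (q, r')), w') \<in> set exc" "w' \<le> w"
    using assms by (meson coversE)
  have "\<forall>((p, r), v)\<in>set lower. \<forall>((x', (q, r')), v')\<in>set exc.
        x' = (p, r) \<longrightarrow> covers lower (q, r') (v * v' * Fin (r - r'))"
    using ok unfolding certifies_def case_prod_conv by (elim conjE)
  from bspec[OF bspec[OF this v'(1), unfolded case_prod_conv] w'(1), unfolded case_prod_conv]
  have "covers lower (q, r') (v' * w' * Fin (r - r'))" by blast
  then show ?thesis by (rule covers_mono) (intro zmax_times_mono v' w' order_refl)
qed

lemma upper_step:
  assumes "covers upper (p, r) v" "(p, q, a, b, c, d) \<in> set Es"
  shows "shift_edge a b d \<Longrightarrow> N \<le> r + (weight a - weight d) \<Longrightarrow>
      covers upper (q, r + (weight a - weight d) - N) (v * a)"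
    and "a \<noteq> NegInf \<Longrightarrow> b \<noteq> NegInf \<or> d = NegInf \<Longrightarrow> b \<le> a \<Longrightarrow> covers base (q, gap a b) (v * a)"
proof -
  obtain v' where v': "((p, r), v') \<in> set upper" "v' \<le> v"
    using assms by (meson coversE)
  have "\<forall>((p, r), v)\<in>set upper. \<forall>(p', q, a, b, c, d)\<in>set Es. p' = p \<longrightarrow>
        (shift_edge a b d \<and> N \<le> r + (weight a - weight d) \<longrightarrow>
           covers upper (q, r + (weight a - weight d) - N) (v * a)) \<and>
        (a \<noteq> NegInf \<and> (b \<noteq> NegInf \<or> d = NegInf) \<and> b \<le> a \<longrightarrow>
           covers base (q, gap a b) (v * a))"
    using ok unfolding certifies_def case_prod_conv by (elim conjE)
  note step = bspec[OF bspec[OF this v'(1), unfolded case_prod_conv] assms(2), unfolded case_prod_conv]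
  have le: "v' * a \<le> v * a" by (intro zmax_times_mono v' order_refl)
  show "shift_edge a b d \<Longrightarrow> N \<le> r + (weight a - weight d) \<Longrightarrow>
      covers upper (q, r + (weight a - weight d) - N) (v * a)"
    by (rule covers_mono[OF _ le]) (use step in blast)
  show "a \<noteq> NegInf \<Longrightarrow> b \<noteq> NegInf \<or> d = NegInf \<Longrightarrow> b \<le> a \<Longrightarrow> covers base (q, gap a b) (v * a)"
    by (rule covers_mono[OF _ le]) (use step in blast)
qed

lemma lower_step:
  assumes "covers lower (p, r) v" "(p, q, a, b, c, d) \<in> set Es"
  shows "shift_edge a b d \<Longrightarrow> N \<le> r + (weight a - weight d) \<Longrightarrow>
      covers lower (q, r + (weight a - weight d) - N) (v * d)"
    and "a = NegInf \<Longrightarrow> b = NegInf \<Longrightarrow> c = NegInf \<Longrightarrow> d = NegInf \<Longrightarrow> q \<in> set dead"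
    and "a = NegInf \<Longrightarrow> b = NegInf \<Longrightarrow> c \<noteq> NegInf \<Longrightarrow> d \<le> c \<Longrightarrow> covers base (q, gap c d) (v * c)"
proof -
  obtain v' where v': "((p, r), v') \<in> set lower" "v' \<le> v"
    using assms by (meson coversE)
  have "\<forall>((p, r), v)\<in>set lower. \<forall>(p', q, a, b, c, d)\<in>set Es. p' = p \<longrightarrow>
        (shift_edge a b d \<and> N \<le> r + (weight a - weight d) \<longrightarrow>
           covers lower (q, r + (weight a - weight d) - N) (v * d)) \<and>
        (a = NegInf \<and> b = NegInf \<and> d \<le> c \<longrightarrow>
           (if c = NegInf then \<exists>q'\<in>set dead. q' = q else covers base (q, gap c d) (v * c)))"
    using ok unfolding certifies_def case_prod_conv by (elim conjE)
  note step = bspec[OF bspec[OF this v'(1), unfolded case_prod_conv] assms(2), unfolded case_prod_conv]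
  have le: "v' * x \<le> v * x" for x by (intro zmax_times_mono v' order_refl)
  show "shift_edge a b d \<Longrightarrow> N \<le> r + (weight a - weight d) \<Longrightarrow>
      covers lower (q, r + (weight a - weight d) - N) (v * d)"
    by (rule covers_mono[OF _ le]) (use step in blast)
  show "a = NegInf \<Longrightarrow> b = NegInf \<Longrightarrow> c = NegInf \<Longrightarrow> d = NegInf \<Longrightarrow> q \<in> set dead"
    using step by auto
  show "a = NegInf \<Longrightarrow> b = NegInf \<Longrightarrow> c \<noteq> NegInf \<Longrightarrow> d \<le> c \<Longrightarrow> covers base (q, gap c d) (v * c)"
    by (rule covers_mono[OF _ le]) (use step in auto)
qed

lemma final:
  shows "t \<notin> set dead" and "covers base (t, g) v \<Longrightarrow> Fin 0 \<le> v" and "covers upper (t, r) v \<Longrightarrow> Fin 0 \<le> v"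
proof -
  have *: "\<forall>p\<in>set dead. p \<noteq> t" "\<forall>((p, g), v)\<in>set base. p = t \<longrightarrow> Fin 0 \<le> v"
    "\<forall>((p, r), v)\<in>set upper. p = t \<longrightarrow> Fin 0 \<le> v"
    using ok unfolding certifies_def case_prod_conv by - (elim conjE, assumption)+
  show "t \<notin> set dead" using *(1) by blast
  show "covers base (t, g) v \<Longrightarrow> Fin 0 \<le> v" using *(2) by (elim coversE) (force intro: order_trans)
  show "covers upper (t, r) v \<Longrightarrow> Fin 0 \<le> v" using *(3) by (elim coversE) (force intro: order_trans)
qed


text \<open>A derivation is a stack. Its ground is a base entry on level 1, and each use of
  \<open>up\<close> adds a frame consisting of a climbing edge and the excursion made since that
  climb. Keeping the frames apart allows a later descent to be matched with its climb.\<close>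

inductive level :: "nat \<Rightarrow> 'p \<Rightarrow> int \<Rightarrow> zmax \<Rightarrow> bool" where
  ground: "covers base (p, Fin (- N - r)) v \<Longrightarrow> 0 \<le> r \<Longrightarrow> r < N \<Longrightarrow> level 1 p r v"
| up: "level j p r v \<Longrightarrow> (p, q, a, b, c, d) \<in> set Es \<Longrightarrow> shift_edge a b d \<Longrightarrow>
    N \<le> r + (weight a - weight d) \<Longrightarrow>
    covers exc ((q, r + (weight a - weight d) - N), (z, r')) v' \<Longrightarrow>
    level (Suc j) z r' (v * a * v')"

lemma level_pos: "level j p r v \<Longrightarrow> 0 < j"
  by (induction rule: level.induct) auto

text \<open>A shift edge changes the residue by less than \<open>N\<close>, so it crosses at most
  one boundary: it extends the top of the stack, pushes a frame or pops one. Descending from the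
  ground leads back to a base entry with difference below \<open>N\<close>.\<close>

lemma level_step:
  assumes "level j p r v" and r: "0 \<le> r" "r < N" and e: "(p, q, a, b, c, d) \<in> set Es" "shift_edge a b d"
  defines "r' \<equiv> r + (weight a - weight d)"
  shows "0 \<le> r' \<Longrightarrow> r' < N \<Longrightarrow> level j q r' (v * a)"
    and "N \<le> r' \<Longrightarrow> level (Suc j) q (r' - N) (v * a)"
    and "r' < 0 \<Longrightarrow> j = 1 \<Longrightarrow> covers base (q, Fin (- N - r')) (v * a)"
    and "r' < 0 \<Longrightarrow> 1 < j \<Longrightarrow> level (j - 1) q (r' + N) (v * a)"
proof -
  obtain x y where xy: "a = Fin x" "b = NegInf" "d = Fin y" "x - y < N" "y - x < N"
    and c: "\<And>z. c = Fin z \<Longrightarrow> z - x < N"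
    using e by (rule edge_weights) blast
  have r': "r' = r + (x - y)" by (simp add: r'_def xy)
  \<comment> \<open>On level 1 the base rule acts as a shift: the second component lies at least
    \<open>N\<close> below the first, so \<open>c\<close> cannot compete with \<open>a\<close>. The
    condition \<open>r' < N\<close> keeps the new difference below 2 * N.\<close>
  have base: "covers base (q, Fin (- N - r')) (v * a)"
    if "covers base (p, Fin (- N - r)) v" "r' < N"
  proof -
    have a: "a + Fin (- N - r) * c = a"
      using c r N_pos by (cases c) (auto simp: xy)
    have d: "b + Fin (- N - r) * d = Fin (- N - r + y)"
      by (simp add: xy)
    have "covers base (q, gap a (Fin (- N - r + y))) (v * a)"
      using base_step(2)[OF that(1) e(1)] r xy that(2) unfolding a d r' by auto
    then show ?thesis by (simp add: gap_def xy r' algebra_simps)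
  qed
  show "r' < 0 \<Longrightarrow> j = 1 \<Longrightarrow> covers base (q, Fin (- N - r')) (v * a)"
    using assms(1) N_pos by (cases rule: level.cases) (auto intro: base dest: level_pos)
  show "level j q r' (v * a)" if "0 \<le> r'" "r' < N"
    using assms(1)
  proof (cases rule: level.cases)
    case ground
    then show ?thesis using base[OF _ that(2)] that level.ground[of q r' "v * a"] by simp
  next
    case (up i z0 r0 v0 q0 a0 b0 c0 d0 v1)
    have "covers exc ((q0, r0 + (weight a0 - weight d0) - N), (q, r')) (v1 * a)"
      using exc_step[OF up(7) e] that by (simp add: r'_def)
    from level.up[OF up(3-6) this] show ?thesis using up(1,2) by (simp add: mult.assoc)
  qed
  show "level (Suc j) q (r' - N) (v * a)" if "N \<le> r'"
  proof -
    have "covers exc ((q, r' - N), (q, r' - N)) (Fin 0)"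
      using that r xy(4) by (intro exc_refl[OF e(1)]) (auto simp: r')
    from level.up[OF assms(1) e that[unfolded r'_def] this[unfolded r'_def]]
    show ?thesis by (simp add: r'_def one_zmax_def[symmetric])
  qed
  show "level (j - 1) q (r' + N) (v * a)" if neg: "r' < 0" and "1 < j"
    using assms(1)
  proof (cases rule: level.cases)
    case ground
    then show ?thesis using that by simp
  next
    case (up i z0 r0 v0 q0 a0 b0 c0 d0 v1)
    \<comment> \<open>The climb \<open>a0\<close>, the excursion \<open>v1\<close> above it and the
      descent \<open>a\<close> form one excursion on the level below, appended to any excursion that
      ends at the foot of the climb.\<close>
    have down: "covers exc (x, (q, r' + N)) (w * a0 * v1 * a)"
      if "covers exc (x, (z0, r0)) w" for x w
      using exc_up_down[OF that up(4-7) e] neg by (simp add: r'_def)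
    have bounds: "0 \<le> r' + N" "r' + N < N"
      using neg r xy by (auto simp: r')
    from up(3) show ?thesis
    proof (cases rule: level.cases)
      case ground
      \<comment> \<open>Below the popped frame lies the ground, so a trivial excursion is extended
        and then absorbed into the base entry by \<open>base_exc\<close>.\<close>
      have "covers exc ((z0, r0), (q, r' + N)) (Fin 0 * a0 * v1 * a)"
        by (intro down exc_refl[OF up(4)] ground)
      from level.ground[OF base_exc[OF ground(2) this] bounds] show ?thesis
        using up(1,2) ground(1) by (simp add: mult.assoc flip: one_zmax_def)
    next
      case (up i' z' r'' v0' q' a' b' c' d' v1')
      from down[OF up(7)]
      have "covers exc ((q', r'' + (weight a' - weight d') - N), (q, r' + N)) (v1' * a0 * v1 * a)" .
      from level.up[OF up(3-6) this] show ?thesis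
        using up(1,2) \<open>j = Suc i\<close> \<open>v = v0 * a0 * v1\<close> by (simp add: mult.assoc)
    qed
  qed
qed

text \<open>Both tables forget the height of the stack. The second component is the first minus
  \<open>N * int j + r\<close>; a climb changes it by \<open>d\<close>, an excursion by its weight
  and the drop of the residue, and neither amount depends on \<open>j\<close>.\<close>

lemma level_upper_lower:
  assumes "level j p r v"
  shows "covers upper (p, r) v" "covers lower (p, r) (v * Fin (- (N * int j + r)))"
proof -
  have "covers upper (p, r) v \<and> covers lower (p, r) (v * Fin (- (N * int j + r)))"
    using assms
  proof induction
    case (ground p r v)
    then show ?case using base_upper_lower[of p r v] by (simp add: algebra_simps)
  next
    case (up j p r v q a b c d z r' v')
    obtain x y where xy: "a = Fin x" "b = NegInf" "d = Fin y"
      using up by (elim edge_weights)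
    have "covers upper (z, r') (v * a * v')"
      using up by (intro upper_exc[OF upper_step(1)]) blast+
    moreover have "covers lower (z, r') (v * Fin (- (N * int j + r)) * d * v' *
        Fin (r + (weight a - weight d) - N - r'))"
      using up by (intro lower_exc[OF lower_step(1)]) blast+
    moreover have "v * Fin (- (N * int j + r)) * d * v' * Fin (r + (weight a - weight d) - N - r')
        = v * a * v' * Fin (- (N * int (Suc j) + r'))"
      by (cases v; cases v') (auto simp: xy algebra_simps)
    ultimately show ?case by simp
  qed
  then show "covers upper (p, r) v" "covers lower (p, r) (v * Fin (- (N * int j + r)))" by auto
qed

text \<open>From difference \<open>N\<close> on a whole stack is carried, because a single bound
  would not survive a descent. On reachable vectors the first clause concerns (NegInf, NegInf) only,
  by \<open>reach_le\<close>.\<close>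

fun invariant :: "'p \<Rightarrow> zmax \<Rightarrow> zmax \<Rightarrow> bool" where
  "invariant p NegInf l \<longleftrightarrow> p \<in> set dead"
| "invariant p (Fin x) NegInf \<longleftrightarrow> covers base (p, NegInf) (Fin x)"
| "invariant p (Fin x) (Fin y) \<longleftrightarrow>
    (if x - y < N then covers base (p, Fin (y - x)) (Fin x)
     else \<exists>j r v. level j p r v \<and> 0 < j \<and> 0 \<le> r \<and> r < N \<and> x - y = N * int j + r \<and> v \<le> Fin x)"

lemma invariant_level:
  assumes "level j q r v" "0 \<le> r" "r < N" "x - y = N * int j + r" "v \<le> Fin x"
  shows "invariant q (Fin x) (Fin y)"
proof -
  have "N * 1 \<le> N * int j" using N_pos level_pos[OF assms(1)] by (intro mult_left_mono) auto
  then have "\<not> x - y < N" using assms(2,4) by linarith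
  then show ?thesis using assms level_pos[OF assms(1)] by (simp only: invariant.simps if_False) blast
qed

text \<open>A base entry with a difference of at least \<open>N\<close> and below 2 * N becomes the
  ground of a new stack on level 1. This is why the base table has to extend beyond
  \<open>N\<close>.\<close>

lemma invariant_base:
  assumes "covers base (q, gap e f) (Fin x * e)" "e \<noteq> NegInf"
    "f = NegInf \<or> weight e - weight f < N + N"
  shows "invariant q (Fin x * e) (Fin x * f)"
proof (cases e)
  case (Fin y)
  show ?thesis
  proof (cases f)
    case NegInf
    then show ?thesis using assms by (simp add: Fin gap_def)
  next
    case f: (Fin z)
    show ?thesis
    proof (cases "y - z < N")
      case True
      then show ?thesis using assms by (simp add: Fin f gap_def)
    next
      case False
      then have "level 1 q (y - z - N) (Fin (x + y))"
        using assms by (intro level.ground) (auto simp: Fin f gap_def)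
      then have "\<exists>j r v. level j q r v \<and> 0 < j \<and> 0 \<le> r \<and> r < N \<and>
          (x + y) - (x + z) = N * int j + r \<and> v \<le> Fin (x + y)"
        using False assms(3)
        by (intro exI[of _ "1 :: nat"] exI[of _ "y - z - N"] exI[of _ "Fin (x + y)"]) (auto simp: Fin f)
      with False show ?thesis by (simp add: Fin f)
    qed
  qed
qed (use assms in simp)

lemma invariant_step_base:
  assumes base: "covers base (p, g) (Fin x)" and e: "(p, q, a, b, c, d) \<in> set Es"
    and g: "g = NegInf \<or> - N < weight g \<and> weight g \<le> 0"
    and le: "Fin x * (b + g * d) \<le> Fin x * (a + g * c)"
  shows "invariant q (Fin x * (a + g * c)) (Fin x * (b + g * d))"
proof (cases "a + g * c = NegInf")
  case True
  then show ?thesis using base_step(1)[OF base e] le by simp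
next
  case False
  have small': "weight y - weight z < N" if "y \<in> {a, b, c, d}" "z \<in> {a, b, c, d}"
    "y \<noteq> NegInf" "z \<noteq> NegInf" for y z using small[OF e that] .
  \<comment> \<open>The extreme case is b = NegInf with \<open>a\<close> in front: the new
    difference is \<open>a - d - g\<close>, where a - d < N and - g < N. This is the origin of the
    bound 2 * N.\<close>
  have "b + g * d = NegInf \<or> weight (a + g * c) - weight (b + g * d) < N + N"
    using False g small'[of a b] small'[of a d] small'[of c d] small'[of c b] N_pos
    by (cases a; cases b; cases c; cases d; cases g) (auto simp: max_def)
  with False base_step(2)[OF base e] le show ?thesis
    by (intro invariant_base) auto
qed

lemma invariant_step_level:
  assumes lev: "level j p r v" "0 < j" "0 \<le> r" "r < N" "x - y = N * int j + r" "v \<le> Fin x"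
    and e: "(p, q, a, b, c, d) \<in> set Es"
    and le: "Fin x * b + Fin y * d \<le> Fin x * a + Fin y * c"
  shows "invariant q (Fin x * a + Fin y * c) (Fin x * b + Fin y * d)"
proof -
  have "N * 1 \<le> N * int j" using N_pos lev(2) by (intro mult_left_mono) auto
  then have N: "N \<le> x - y" using lev(3,5) by linarith
  note upper = covers_mono[OF level_upper_lower(1)[OF lev(1)] lev(6)]
  have lower: "covers lower (p, r) (Fin y)"
  proof (rule covers_mono[OF level_upper_lower(2)[OF lev(1)]])
    have "v * Fin (- (N * int j + r)) \<le> Fin x * Fin (- (N * int j + r))"
      using lev(6) by (intro zmax_times_mono) auto
    also have "Fin x * Fin (- (N * int j + r)) = Fin y" using lev(5) by simp
    finally show "v * Fin (- (N * int j + r)) \<le> Fin y" .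
  qed
  have small': "weight y - weight z < N" if "y \<in> {a, b, c, d}" "z \<in> {a, b, c, d}"
    "y \<noteq> NegInf" "z \<noteq> NegInf" for y z using small[OF e that] .
  \<comment> \<open>At differences of at least \<open>N\<close> four things can happen: the edge
    shifts the difference, keeps only the first component, keeps only the second, or would make the
    second component the larger one, which \<open>le\<close> excludes.\<close>
  consider "shift_edge a b d" | "a \<noteq> NegInf" "b \<noteq> NegInf \<or> d = NegInf" | "a = NegInf" "b = NegInf"
    | "a = NegInf" "b \<noteq> NegInf"
    unfolding shift_edge_def by blast
  then show ?thesis
  proof cases
    case 1
    obtain x' y' where xy': "a = Fin x'" "b = NegInf" "d = Fin y'" "x' - y' < N" "y' - x' < N"
      and c: "\<And>z. c = Fin z \<Longrightarrow> z - x' < N"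
      using e 1 by (rule edge_weights) blast
    have u: "Fin x * a + Fin y * c = Fin (x + x')"
      using c N by (cases c) (force simp: xy')+
    have l: "Fin x * b + Fin y * d = Fin (y + y')" by (simp add: xy')
    have v: "v * a \<le> Fin (x + x')"
      using zmax_times_mono[OF lev(6) order_refl, of a] by (simp add: xy')
    define r' where "r' = r + (weight a - weight d)"
    have r': "r' = r + (x' - y')" by (simp add: r'_def xy')
    note step = level_step[OF lev(1,3,4) e 1, folded r'_def]
    have D: "(x + x') - (y + y') = N * int j + r'" using lev(5) by (simp add: r')
    consider "0 \<le> r'" "r' < N" | "N \<le> r'" | "r' < 0" "j = 1" | "r' < 0" "1 < j"
      using lev(2) by linarith
    then show ?thesis
    proof cases
      case 1
      show ?thesis unfolding u l using step(1)[OF 1] 1 D v by (rule invariant_level)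
    next
      case 2
      have "(x + x') - (y + y') = N * int (Suc j) + (r' - N)"
        using D by (simp add: algebra_simps)
      moreover have "0 \<le> r' - N" "r' - N < N" using 2 lev(4) xy' by (auto simp: r')
      ultimately show ?thesis unfolding u l using step(2)[OF 2] v by (intro invariant_level)
    next
      case 3
      then have "(x + x') - (y + y') < N" "- N - r' = (y + y') - (x + x')" using D by simp_all
      then show ?thesis unfolding u l using covers_mono[OF step(3)[OF 3] v] by simp
    next
      case 4
      have "(x + x') - (y + y') = N * int (j - 1) + (r' + N)"
        using D 4 by (simp add: algebra_simps of_nat_diff)
      moreover have "0 \<le> r' + N" "r' + N < N" using 4 lev(3) xy' by (auto simp: r')
      ultimately show ?thesis unfolding u l using step(4)[OF 4] v by (intro invariant_level)
    qed
  next
    case 2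
    obtain x' where a: "a = Fin x'" using 2 by (cases a) auto
    have u: "Fin x * a + Fin y * c = Fin x * a"
      using small'[of c a] N by (cases c) (auto simp: a)
    have l: "Fin x * b + Fin y * d = Fin x * b"
      using small'[of d b] N 2 by (cases d; cases b) auto
    have "b \<le> a" using le unfolding u l by simp
    then have "covers base (q, gap a b) (Fin x * a)" using upper_step(2)[OF upper e] 2 by blast
    moreover have "b = NegInf \<or> weight a - weight b < N + N"
    proof (cases "b = NegInf")
      case False
      then show ?thesis using small'[of a b] 2 N_pos by simp
    qed simp
    ultimately show ?thesis unfolding u l using 2 by (intro invariant_base)
  next
    case 3
    then show ?thesis
    proof (cases "c = NegInf")
      case True
      then show ?thesis using 3 le lower_step(2)[OF lower e] by simp
    next
      case False
      have "covers base (q, gap c d) (Fin y * c)"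
        using 3 False le by (intro lower_step(3)[OF lower e]) auto
      moreover have "d = NegInf \<or> weight c - weight d < N + N"
      proof (cases "d = NegInf")
        case d: False
        then show ?thesis using small'[of c d] False N_pos by simp
      qed simp
      ultimately have "invariant q (Fin y * c) (Fin y * d)" using False by (intro invariant_base)
      then show ?thesis using 3 by simp
    qed
  next
    case 4
    then obtain z where b: "b = Fin z" by (cases b) auto
    from le 4 show ?thesis
      using small'[of c b] N by (cases c; cases d) (auto simp: b)
  qed
qed

lemma invariant_reach: "reach (set Es) s p u l \<Longrightarrow> invariant p u l"
proof (induction rule: reach.induct)
  case start
  show ?case using base_start by simp
next
  case (step p u l q a b c d)
  have "l \<le> u" using step.hyps(1) by (rule reach_le)
  show ?case
  proof (cases u)
    case NegInf
    with \<open>l \<le> u\<close> have "l = NegInf" by simp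
    then show ?thesis using step NegInf by (auto intro: dead_step)
  next
    case u: (Fin x)
    show ?thesis
    proof (cases l)
      case NegInf
      with u step invariant_step_base[of p NegInf x q a b c d] show ?thesis by simp
    next
      case l: (Fin y)
      show ?thesis
      proof (cases "x - y < N")
        case True
        then have base: "covers base (p, Fin (y - x)) (Fin x)"
          using step.IH u l by simp
        \<comment> \<open>Dividing by \<open>u\<close> brings a vector with small difference into
          the normal form of a base key.\<close>
        have eq: "u * e + l * f = Fin x * (e + Fin (y - x) * f)" for e f
          by (cases e; cases f) (auto simp: u l)
        show ?thesis unfolding eq
          using \<open>l \<le> u\<close> True step.hyps(3)[unfolded eq] u l
          by (intro invariant_step_base[OF base step.hyps(2)]) auto
      next
        case False
        then show ?thesis using step.IH step.hyps(2,3) invariant_step_level unfolding u l by auto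
      qed
    qed
  qed
qed

theorem no_negative_reach:
  assumes "reach (set Es) s t u l"
  shows "Fin 0 \<le> u"
proof -
  have inv: "invariant t u l" using assms by (rule invariant_reach)
  show ?thesis
  proof (cases u)
    case NegInf
    then show ?thesis using inv final(1) by simp
  next
    case u: (Fin x)
    show ?thesis
    proof (cases l)
      case NegInf
      then show ?thesis using inv final(2)[of NegInf "Fin x"] by (simp add: u)
    next
      case l: (Fin y)
      consider "covers base (t, Fin (y - x)) (Fin x)" | j r v where "level j t r v" "v \<le> Fin x"
        using inv by (auto simp: u l split: if_splits)
      then show ?thesis
        unfolding u by cases (blast intro: final order_trans level_upper_lower)+
    qed
  qed
qed

end

subsection \<open>Completeness of certificates\<close>

definition infimum :: "int set \<Rightarrow> zmax" where
  "infimum S = (if bdd_below S then Fin (Inf S) else NegInf)"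

lemma infimum_greatest:
  assumes "S \<noteq> {}" "\<And>x. x \<in> S \<Longrightarrow> v \<le> Fin x"
  shows "v \<le> infimum S"
proof (cases v)
  case (Fin c)
  then have "bdd_below S" "c \<le> Inf S"
    using assms by (force intro: bdd_belowI, force intro!: cInf_greatest)
  then show ?thesis by (simp add: infimum_def Fin)
qed simp

text \<open>A lower bound of \<open>U\<close> and a point of \<open>T\<close> bound \<open>S\<close>
  from below; then the infimum of \<open>S\<close> bounds \<open>T\<close>. If \<open>U\<close> is
  unbounded, the left side is \<open>NegInf\<close>. In this way the closure of value sets under
  concatenation of paths becomes an inequality between table entries.\<close>

lemma infimum_plus:
  assumes "S \<noteq> {}" "T \<noteq> {}" "\<And>x y. x \<in> S \<Longrightarrow> y \<in> T \<Longrightarrow> x + y + w \<in> U"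
  shows "infimum U \<le> infimum S * infimum T * Fin w"
proof (cases "bdd_below U")
  case True
  have "Fin (Inf U - w - y) \<le> infimum S" if y: "y \<in> T" for y
  proof (rule infimum_greatest)
    show "Fin (Inf U - w - y) \<le> Fin x" if "x \<in> S" for x
      using cInf_lower[OF assms(3)[OF that y] True] by simp
  qed fact
  moreover obtain y0 where "y0 \<in> T" using assms(2) by blast
  ultimately obtain i where i: "infimum S = Fin i" by (cases "infimum S") force+
  then have "Fin (Inf U - w - i) \<le> Fin y" if "y \<in> T" for y
    using \<open>\<And>y. y \<in> T \<Longrightarrow> Fin (Inf U - w - y) \<le> infimum S\<close>[OF that] by simp
  then have "Fin (Inf U - w - i) \<le> infimum T"
    by (rule infimum_greatest[OF assms(2)])
  with True i show ?thesis by (cases "infimum T") (auto simp: infimum_def)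
qed (simp add: infimum_def)

lemma infimum_zero: "infimum {0} = Fin 0"
  by (simp add: infimum_def)

text \<open>Empty sets get no entry: their keys cannot occur, and the infimum of an empty set of
  integers has no meaningful value.\<close>

definition tabulates :: "('k \<times> zmax) list \<Rightarrow> ('k \<Rightarrow> int set) \<Rightarrow> bool" where
  "tabulates L S \<longleftrightarrow> set L = (\<lambda>k. (k, infimum (S k))) ` {k. S k \<noteq> {}}"

lemma ex_tabulates: "finite {k. S k \<noteq> {}} \<Longrightarrow> \<exists>L. tabulates L S"
  unfolding tabulates_def by (rule finite_list) simp

lemma tabulates_mem: "tabulates L S \<Longrightarrow> (k, v) \<in> set L \<longleftrightarrow> S k \<noteq> {} \<and> v = infimum (S k)"
  unfolding tabulates_def by auto

lemma covers_plus:
  assumes "tabulates L U" "S \<noteq> {}" "T \<noteq> {}" "\<And>x y. x \<in> S \<Longrightarrow> y \<in> T \<Longrightarrow> x + y + w \<in> U k"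
    "v = infimum S * infimum T * Fin w"
  shows "covers L k v"
proof -
  have "U k \<noteq> {}" using assms(2-4) by blast
  then have "(k, infimum (U k)) \<in> set L" using assms(1) by (simp add: tabulates_mem)
  then show ?thesis using infimum_plus[OF assms(2-4)] assms(5) unfolding covers_def by blast
qed

lemma covers_shift:
  assumes "tabulates L U" "S \<noteq> {}" "\<And>x. x \<in> S \<Longrightarrow> x + w \<in> U k" "v = infimum S * Fin w"
  shows "covers L k v"
  using assms by (intro covers_plus[OF assms(1), of S "{0}"])
    (auto simp: infimum_zero simp flip: one_zmax_def)

lemma ex_small_differences: "\<exists>N>0. \<forall>x\<in>set Es. small_differences N x"
proof (induction Es)
  case Nil
  show ?case by (auto intro: exI[of _ 1])
next
  case (Cons x Es)
  then obtain N where N: "0 < N" "\<forall>x\<in>set Es. small_differences N x" by blast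
  obtain p q a b c d where x: "x = (p, q, a, b, c, d)" by (cases x)
  \<comment> \<open>Differences within this edge are at most 2 * M, so adding 2 * M to
    \<open>N\<close> gives a strict bound for it and preserves the bounds for the other
    edges.\<close>
  define M where "M = \<bar>weight a\<bar> + \<bar>weight b\<bar> + \<bar>weight c\<bar> + \<bar>weight d\<bar>"
  have M: "weight y \<le> M \<and> - weight y \<le> M" if "y \<in> set [a, b, c, d]" for y
    using that by (auto simp: M_def)
  have "weight y - weight z < N + 2 * M" if "y \<in> set [a, b, c, d]" "z \<in> set [a, b, c, d]" for y z
    using N(1) M[OF that(1)] M[OF that(2)] by linarith
  then have "small_differences (N + 2 * M) x"
    unfolding small_differences_def x case_prod_conv by blast
  moreover have "small_differences (N + 2 * M) y" if "small_differences N y" for y :: "'a edge"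
  proof -
    have "0 \<le> M" by (simp add: M_def)
    then have "x < N \<Longrightarrow> x < N + 2 * M" for x by linarith
    then show ?thesis using that unfolding small_differences_def case_prod_unfold by blast
  qed
  ultimately show ?case using N by (intro exI[of _ "N + 2 * M"]) (auto simp: M_def)
qed

section \<open>Value sets of a nonnegative system and their closure properties\<close>

locale nonnegative_system =
  fixes Es :: "'p edge list" and s t :: 'p and N :: int
  assumes N_pos: "0 < N" and small_differences: "\<And>x. x \<in> set Es \<Longrightarrow> small_differences N x"
    and nonneg: "\<And>u l. reach (set Es) s t u l \<Longrightarrow> Fin 0 \<le> u"
begin

lemmas small = small_differencesD[OF small_differences]

lemmas edge_weights = shift_edge_weights[OF small_differences]

abbreviation reachable :: "'p \<Rightarrow> zmax \<Rightarrow> zmax \<Rightarrow> bool" where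
  "reachable \<equiv> reach (set Es) s"

lemma reachable_step:
  assumes "reachable p u l" "(p, q, a, b, c, d) \<in> set Es"
    "u' = u * a + l * c" "l' = u * b + l * d" "l' \<le> u'"
  shows "reachable q u' l'"
  using assms reach.step by metis

lemma reachable_shift:
  assumes "reachable p (Fin x) (Fin y)" "(p, q, a, b, c, d) \<in> set Es" "shift_edge a b d" "N \<le> x - y"
  shows "reachable q (Fin (x + weight a)) (Fin (y + weight d))"
proof -
  obtain a' d' where "a = Fin a'" "b = NegInf" "d = Fin d'" "a' - d' < N" "d' - a' < N"
    and "\<And>z. c = Fin z \<Longrightarrow> z - a' < N"
    using assms(2,3) by (rule edge_weights) blast
  then show ?thesis using assms(4)
    by (intro reachable_step[OF assms(1,2)]) (cases c; force)+
qed

definition nodes :: "'p set" where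
  "nodes = insert s (\<Union>(p, q, _)\<in>set Es. {p, q})"

lemma finite_nodes: "finite nodes"
  unfolding nodes_def by (auto split: prod.splits)

lemma edge_nodes: "(p, q, a, b, c, d) \<in> set Es \<Longrightarrow> p \<in> nodes \<and> q \<in> nodes"
  unfolding nodes_def by fastforce

lemma reachable_nodes: "reachable p u l \<Longrightarrow> p \<in> nodes"
  by (induction rule: reach.induct) (auto simp: edge_nodes, auto simp: nodes_def)

text \<open>Here \<open>D\<close> is the difference measured from the bottom of the level on which the excursion starts.\<close>

inductive excursion :: "'p \<Rightarrow> int \<Rightarrow> 'p \<Rightarrow> int \<Rightarrow> int \<Rightarrow> bool" for p r where
  refl: "p \<in> nodes \<Longrightarrow> 0 \<le> r \<Longrightarrow> r < N \<Longrightarrow> excursion p r p r 0"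
| step: "excursion p r z D w \<Longrightarrow> (z, q, a, b, c, d) \<in> set Es \<Longrightarrow> shift_edge a b d \<Longrightarrow>
    0 \<le> D + (weight a - weight d) \<Longrightarrow>
    excursion p r q (D + (weight a - weight d)) (w + weight a)"

lemma excursion_bounds:
  "excursion p r q D w \<Longrightarrow> p \<in> nodes \<and> q \<in> nodes \<and> 0 \<le> r \<and> r < N \<and> 0 \<le> D"
  by (induction rule: excursion.induct) (auto simp: edge_nodes)

text \<open>Lowering the floor by \<open>N\<close> only weakens the conditions on the difference, so
  an excursion one level up can be replayed after a path that has climbed to its start.\<close>

lemma excursion_above:
  assumes "excursion z r q D w" "excursion p r' z (r + N) w'"
  shows "excursion p r' q (D + N) (w' + w)"
  using assms
proof induction
  case (step z D w q a b c d)
  have "0 \<le> D" using step.hyps(1) excursion_bounds by blast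
  then show ?case
    using excursion.step[OF step.IH[OF step.prems] step.hyps(2,3)] step.hyps(4) N_pos
    by (simp add: algebra_simps)
qed simp

text \<open>Since \<open>N \<le> K\<close>, the difference never falls below \<open>N\<close>, and
  every edge of the excursion really acts as a shift. The increase \<open>w\<close> is the same for
  all \<open>K\<close>, so one table serves every level.\<close>

lemma excursion_reachable:
  assumes "excursion p r q D w" "reachable p (Fin x) (Fin y)" "x - y = r + K" "N \<le> K"
  shows "reachable q (Fin (x + w)) (Fin (x + w - (D + K)))"
  using assms(1)
proof induction
  case refl
  have "y = x - (r + K)" using assms(3) by simp
  then show ?case using assms(2) by simp
next
  case (step z D w q a b c d)
  have "0 \<le> D" using step.hyps(1) excursion_bounds by blast
  then show ?case
    using reachable_shift[OF step.IH step.hyps(2,3)] assms(4) by (simp add: algebra_simps)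
qed

definition base_values :: "'p \<times> zmax \<Rightarrow> int set" where
  "base_values = (\<lambda>(p, g). {x. reachable p (Fin x) (Fin x * g) \<and> (g = NegInf \<or> - (N + N) < weight g)})"

text \<open>The union over all levels keeps the number of keys finite; the level survives only as
  the witness \<open>j\<close>.\<close>

definition upper_values :: "'p \<times> int \<Rightarrow> int set" where
  "upper_values = (\<lambda>(p, r). {x. 0 \<le> r \<and> r < N \<and> (\<exists>j\<ge>1. reachable p (Fin x) (Fin (x - (N * j + r))))})"

definition lower_values :: "'p \<times> int \<Rightarrow> int set" where
  "lower_values = (\<lambda>(p, r). {y. 0 \<le> r \<and> r < N \<and> (\<exists>j\<ge>1. reachable p (Fin (y + (N * j + r))) (Fin y))})"

definition exc_values :: "('p \<times> int) \<times> ('p \<times> int) \<Rightarrow> int set" where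
  "exc_values = (\<lambda>((p, r), (q, r')). {w. excursion p r q r' w \<and> r' < N})"

text \<open>States come from the finite set \<open>nodes\<close>, residues lie between 0 and
  \<open>N\<close>, and \<open>reach_le\<close> confines a finite \<open>g\<close> to the interval
  from - 2 * N to 0.\<close>

lemma finite_keys:
  "finite {k. base_values k \<noteq> {}}" "finite {k. upper_values k \<noteq> {}}"
  "finite {k. lower_values k \<noteq> {}}" "finite {k. exc_values k \<noteq> {}}"
proof -
  have "g \<in> insert NegInf (Fin ` {- (N + N)..0})"
    if "reachable p (Fin x) (Fin x * g)" "g = NegInf \<or> - (N + N) < weight g" for p g x
    using that reach_le[OF that(1)] by (cases g) auto
  then have "{k. base_values k \<noteq> {}} \<subseteq> nodes \<times> insert NegInf (Fin ` {- (N + N)..0})"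
    unfolding base_values_def using reachable_nodes by fastforce
  then show "finite {k. base_values k \<noteq> {}}"
    by (rule finite_subset) (simp add: finite_nodes)
  have "{k. upper_values k \<noteq> {}} \<subseteq> nodes \<times> {0..N}"
    unfolding upper_values_def using reachable_nodes by fastforce
  then show "finite {k. upper_values k \<noteq> {}}"
    by (rule finite_subset) (simp add: finite_nodes)
  have "{k. lower_values k \<noteq> {}} \<subseteq> nodes \<times> {0..N}"
    unfolding lower_values_def using reachable_nodes by fastforce
  then show "finite {k. lower_values k \<noteq> {}}"
    by (rule finite_subset) (simp add: finite_nodes)
  have "{k. exc_values k \<noteq> {}} \<subseteq> (nodes \<times> {0..N}) \<times> (nodes \<times> {0..N})"
    unfolding exc_values_def using excursion_bounds by fastforce
  then show "finite {k. exc_values k \<noteq> {}}"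
    by (rule finite_subset) (simp add: finite_nodes)
qed

lemma upper_values_I:
  assumes "reachable p (Fin x) (Fin y)" "x - y = N * j + r" "1 \<le> j" "0 \<le> r" "r < N"
  shows "x \<in> upper_values (p, r)"
proof -
  have "y = x - (N * j + r)" using assms(2) by simp
  then show ?thesis using assms(1,3-5) unfolding upper_values_def by blast
qed

lemma lower_values_I:
  assumes "reachable p (Fin x) (Fin y)" "x - y = N * j + r" "1 \<le> j" "0 \<le> r" "r < N"
  shows "y \<in> lower_values (p, r)"
proof -
  have "x = y + (N * j + r)" using assms(2) by simp
  then show ?thesis using assms(1,3-5) unfolding lower_values_def by blast
qed

lemma upper_values_D:
  assumes "x \<in> upper_values (p, r)"
  obtains j y where "reachable p (Fin x) (Fin y)" "x - y = N * j + r" "1 \<le> j" "0 \<le> r" "r < N" "N \<le> x - y"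
proof -
  obtain j where "0 \<le> r" "r < N" "1 \<le> j" "reachable p (Fin x) (Fin (x - (N * j + r)))"
    using assms unfolding upper_values_def by auto
  moreover have "N * 1 \<le> N * j" using N_pos \<open>1 \<le> j\<close> by (intro mult_left_mono) auto
  then have "N \<le> N * j + r" using \<open>0 \<le> r\<close> by linarith
  ultimately show thesis by (intro that) auto
qed

lemma lower_values_D:
  assumes "y \<in> lower_values (p, r)"
  obtains j x where "reachable p (Fin x) (Fin y)" "x - y = N * j + r" "1 \<le> j" "0 \<le> r" "r < N" "N \<le> x - y"
proof -
  obtain j where "0 \<le> r" "r < N" "1 \<le> j" "reachable p (Fin (y + (N * j + r))) (Fin y)"
    using assms unfolding lower_values_def by auto
  moreover have "N * 1 \<le> N * j" using N_pos \<open>1 \<le> j\<close> by (intro mult_left_mono) auto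
  then have "N \<le> N * j + r" using \<open>0 \<le> r\<close> by linarith
  ultimately show thesis by (intro that) auto
qed

lemma base_values_I:
  assumes "reachable q (Fin x * e) (Fin x * f)" "e \<noteq> NegInf"
    "f = NegInf \<or> weight e - weight f < N + N"
  shows "x + weight e \<in> base_values (q, gap e f)"
  using assms unfolding base_values_def gap_def by (cases e; cases f) auto

lemma base_values_step:
  assumes "x \<in> base_values (p, g)" "(p, q, a, b, c, d) \<in> set Es" "b + g * d \<le> a + g * c"
  shows "reachable q (Fin x * (a + g * c)) (Fin x * (b + g * d))"
proof -
  have "reachable p (Fin x) (Fin x * g)" using assms(1) unfolding base_values_def by simp
  then show ?thesis
  proof (rule reachable_step[OF _ assms(2)])
    show "Fin x * (b + g * d) \<le> Fin x * (a + g * c)" using assms(3) by simp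
  qed (simp_all add: algebra_simps)
qed

lemma upper_values_step:
  assumes "x \<in> upper_values (p, r)" "(p, q, a, b, c, d) \<in> set Es"
    "a \<noteq> NegInf" "b \<noteq> NegInf \<or> d = NegInf" "b \<le> a"
  shows "reachable q (Fin x * a) (Fin x * b)"
proof -
  obtain y where y: "reachable p (Fin x) (Fin y)" "N \<le> x - y"
    using assms(1) by (rule upper_values_D)
  have "Fin x * a = Fin x * a + Fin y * c"
    using small[OF assms(2), of c a] assms(3) y(2) by (cases a; cases c) auto
  moreover have "Fin x * b = Fin x * b + Fin y * d"
    using small[OF assms(2), of d b] assms(4) y(2) by (cases b; cases d) auto
  ultimately show ?thesis using assms(5) by (intro reachable_step[OF y(1) assms(2)]) auto
qed

lemma lower_values_step:
  assumes "y \<in> lower_values (p, r)" "(p, q, NegInf, NegInf, c, d) \<in> set Es" "d \<le> c"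
  shows "reachable q (Fin y * c) (Fin y * d)"
proof -
  obtain x where x: "reachable p (Fin x) (Fin y)"
    using assms(1) by (rule lower_values_D)
  show ?thesis using assms(3) by (intro reachable_step[OF x(1) assms(2)]) auto
qed

lemma edge_small_gap:
  assumes "(p, q, a, b, c, d) \<in> set Es"
  shows "a \<noteq> NegInf \<Longrightarrow> b = NegInf \<or> weight a - weight b < N + N"
    and "c \<noteq> NegInf \<Longrightarrow> d = NegInf \<or> weight c - weight d < N + N"
  using small[OF assms, of a b] small[OF assms, of c d] N_pos
  by (cases "b = NegInf"; cases "d = NegInf"; simp)+

lemma upper_values_up:
  assumes "x \<in> upper_values (p, r)" "(p, q, a, b, c, d) \<in> set Es" "shift_edge a b d"
    "N \<le> r + (weight a - weight d)"
  shows "x + weight a \<in> upper_values (q, r + (weight a - weight d) - N)"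
proof -
  obtain j y where y: "reachable p (Fin x) (Fin y)" "x - y = N * j + r" "1 \<le> j" "r < N" "N \<le> x - y"
    using assms(1) by (rule upper_values_D)
  have "weight a - weight d < N" using assms(2,3) by (elim edge_weights) simp_all
  then show ?thesis using y assms(4) reachable_shift[OF y(1) assms(2,3) y(5)]
    by (intro upper_values_I[of _ _ _ "j + 1"]) (auto simp: algebra_simps)
qed

lemma lower_values_up:
  assumes "y \<in> lower_values (p, r)" "(p, q, a, b, c, d) \<in> set Es" "shift_edge a b d"
    "N \<le> r + (weight a - weight d)"
  shows "y + weight d \<in> lower_values (q, r + (weight a - weight d) - N)"
proof -
  obtain j x where x: "reachable p (Fin x) (Fin y)" "x - y = N * j + r" "1 \<le> j" "r < N" "N \<le> x - y"
    using assms(1) by (rule lower_values_D)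
  have "weight a - weight d < N" using assms(2,3) by (elim edge_weights) simp_all
  then show ?thesis using x assms(4) reachable_shift[OF x(1) assms(2,3) x(5)]
    by (intro lower_values_I[of _ _ _ "j + 1"]) (auto simp: algebra_simps)
qed

lemma upper_values_exc:
  assumes "x \<in> upper_values y" "w \<in> exc_values (y, z)"
  shows "x + w \<in> upper_values z"
proof -
  obtain p r q r' where yz: "y = (p, r)" "z = (q, r')" by (cases y; cases z)
  have w: "excursion p r q r' w" "r' < N" using assms(2) unfolding yz exc_values_def by simp_all
  obtain j y where y: "reachable p (Fin x) (Fin y)" "x - y = N * j + r" "1 \<le> j" "0 \<le> r"
    using assms(1) unfolding yz by (rule upper_values_D)
  have "N * 1 \<le> N * j" using N_pos y(3) by (intro mult_left_mono) auto
  then show ?thesis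
    using excursion_reachable[OF w(1) y(1), of "N * j"] y w(2) excursion_bounds[OF w(1)]
    unfolding yz by (intro upper_values_I[of _ _ _ j]) auto
qed

lemma lower_values_exc:
  assumes "y \<in> lower_values (p, r)" "w \<in> exc_values ((p, r), (q, r'))"
  shows "y + w + (r - r') \<in> lower_values (q, r')"
proof -
  have w: "excursion p r q r' w" "r' < N" using assms(2) unfolding exc_values_def by simp_all
  obtain j x where x: "reachable p (Fin x) (Fin y)" "x - y = N * j + r" "1 \<le> j" "0 \<le> r"
    using assms(1) by (rule lower_values_D)
  have "N * 1 \<le> N * j" using N_pos x(3) by (intro mult_left_mono) auto
  moreover have eq: "x + w - (r' + N * j) = y + w + (r - r')" using x(2) by simp
  ultimately have "reachable q (Fin (x + w)) (Fin (y + w + (r - r')))"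
    using excursion_reachable[OF w(1) x(1), of "N * j"] x(2) unfolding eq by simp
  then show ?thesis using x w(2) excursion_bounds[OF w(1)]
    by (intro lower_values_I[of _ "x + w" _ j]) auto
qed

lemma base_values_exc:
  assumes "x \<in> base_values (p, Fin (- N - r))" "w \<in> exc_values ((p, r), (q, r'))"
  shows "x + w \<in> base_values (q, Fin (- N - r'))"
proof -
  have w: "excursion p r q r' w" "r' < N" using assms(2) unfolding exc_values_def by simp_all
  have x: "reachable p (Fin x) (Fin (x - N - r))"
    using assms(1) unfolding base_values_def by (simp add: algebra_simps)
  show ?thesis
    using excursion_reachable[OF w(1) x, of N] w(2)
    unfolding base_values_def by (simp add: algebra_simps)
qed

lemma exc_values_up_down:
  assumes "w \<in> exc_values (x, (p, r))" "(p, q, a, b, c, d) \<in> set Es" "shift_edge a b d"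
    "N \<le> r + (weight a - weight d)"
    "w' \<in> exc_values ((q, r + (weight a - weight d) - N), (p2, r2))"
    "(p2, q2, a', b', c', d') \<in> set Es" "shift_edge a' b' d'"
    "r2 + (weight a' - weight d') < 0"
  shows "w + weight a + w' + weight a' \<in> exc_values (x, (q2, r2 + (weight a' - weight d') + N))"
proof -
  obtain p0 r0 where x: "x = (p0, r0)" by (cases x)
  have w: "excursion p0 r0 p r w" and w': "excursion q (r + (weight a - weight d) - N) p2 r2 w'"
    using assms(1,5) unfolding x exc_values_def by simp_all
  have "excursion p0 r0 q (r + (weight a - weight d)) (w + weight a)"
    using assms(4) N_pos by (intro excursion.step[OF w assms(2,3)]) simp
  with excursion_above[OF w'] have *: "excursion p0 r0 p2 (r2 + N) (w + weight a + w')" by simp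
  \<comment> \<open>The descent removes less than \<open>N\<close> from a difference of at least
    \<open>N\<close>, so the combined path never leaves its starting level downwards.\<close>
  have "weight d' - weight a' < N" using assms(6,7) by (elim edge_weights) simp_all
  moreover have "0 \<le> r2" using excursion_bounds[OF w'] by simp
  ultimately show ?thesis
    using excursion.step[OF * assms(6,7)] assms(8) unfolding x exc_values_def
    by (simp add: algebra_simps)
qed


text \<open>The true infima satisfy all inequalities, because each value set is closed under the
  path extension behind the inequality. Nonnegativity enters through the last three conditions,
  those on \<open>t\<close>.\<close>

theorem ex_certificate: "\<exists>C. certifies Es s t C"
proof -
  obtain base upper lower exc where tab: "tabulates base base_values" "tabulates upper upper_values"
    "tabulates lower lower_values" "tabulates exc exc_values"
    using finite_keys[THEN ex_tabulates] by blast
  have "finite {p. reachable p NegInf NegInf}"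
    using reachable_nodes by (intro finite_subset[OF _ finite_nodes]) blast
  then obtain dead where dead: "set dead = {p. reachable p NegInf NegInf}"
    using finite_list by blast
  note mem = tab[THEN tabulates_mem]
  have dead_I: "\<exists>q'\<in>set dead. q' = q" if "reachable q u l" "u = NegInf" for q u l
    using that reach_le[OF that(1)] unfolding dead by simp
  have base_step: "if a + g * c = NegInf then \<exists>q'\<in>set dead. q' = q
         else b + g * d = NegInf \<or> weight (a + g * c) - weight (b + g * d) < N + N \<longrightarrow>
           covers base (q, gap (a + g * c) (b + g * d)) (v * (a + g * c))"
    if v: "((p, g), v) \<in> set base" and e: "(p, q, a, b, c, d) \<in> set Es"
      and le: "b + g * d \<le> a + g * c" for p g v q a b c d
  proof (cases "a + g * c")
    case NegInf
    obtain x where "x \<in> base_values (p, g)" using v unfolding mem by blast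
    from base_values_step[OF this e le] show ?thesis using dead_I NegInf by simp
  next
    case (Fin i)
    have "covers base (q, gap (a + g * c) (b + g * d)) (v * (a + g * c))"
      if "b + g * d = NegInf \<or> weight (a + g * c) - weight (b + g * d) < N + N"
    proof (rule covers_shift[OF tab(1), of "base_values (p, g)" i])
      show "x + i \<in> base_values (q, gap (a + g * c) (b + g * d))" if "x \<in> base_values (p, g)" for x
        using base_values_I[OF base_values_step[OF that e le]] Fin
          \<open>b + g * d = NegInf \<or> weight (a + g * c) - weight (b + g * d) < N + N\<close> by simp
    qed (use v in \<open>simp_all add: mem Fin\<close>)
    then show ?thesis using Fin by simp
  qed
  have exc_refl: "covers exc ((p, r), (p, r)) (Fin 0)" if "p \<in> nodes" "0 \<le> r" "r < N" for p r
    using excursion.refl[OF that] that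
    by (intro covers_shift[OF tab(4), of "{0}" 0]) (auto simp: exc_values_def infimum_zero)
  have exc_step: "covers exc (x, (q, r + (weight a - weight d))) (v * a)"
    if v: "((x, (p, r)), v) \<in> set exc" and e: "(p, q, a, b, c, d) \<in> set Es" "shift_edge a b d"
      and r: "0 \<le> r + (weight a - weight d)" "r + (weight a - weight d) < N" for x p r v q a b c d
  proof (rule covers_shift[OF tab(4), of "exc_values (x, (p, r))" "weight a"])
    show "w + weight a \<in> exc_values (x, (q, r + (weight a - weight d)))"
      if "w \<in> exc_values (x, (p, r))" for w
      using that excursion.step[OF _ e r(1)] r(2) unfolding exc_values_def by (cases x) auto
    show "v * a = infimum (exc_values (x, (p, r))) * Fin (weight a)"
      using v e(2) by (cases a) (auto simp: mem shift_edge_def)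
  qed (use v in \<open>simp add: mem\<close>)
  have exc_up_down: "covers exc (x, (q2, r2 + (weight a' - weight d') + N)) (v * a * v' * a')"
    if v: "((x, (p, r)), v) \<in> set exc" and e: "(p, q, a, b, c, d) \<in> set Es" "shift_edge a b d"
      "N \<le> r + (weight a - weight d)"
      and v': "(((q, r + (weight a - weight d) - N), (p2, r2)), v') \<in> set exc"
      and e': "(p2, q2, a', b', c', d') \<in> set Es" "shift_edge a' b' d'" "r2 + (weight a' - weight d') < 0"
    for x p r v q a b c d p2 r2 v' q2 a' b' c' d'
  proof (rule covers_plus[OF tab(4), of "exc_values (x, (p, r))"
        "exc_values ((q, r + (weight a - weight d) - N), (p2, r2))" "weight a + weight a'"])
    show "w + w' + (weight a + weight a') \<in> exc_values (x, (q2, r2 + (weight a' - weight d') + N))"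
      if "w \<in> exc_values (x, (p, r))" "w' \<in> exc_values ((q, r + (weight a - weight d) - N), (p2, r2))"
      for w w'
      using exc_values_up_down[OF that(1) e that(2) e'] by (simp add: algebra_simps)
    have "v * a * v' * a' = v * v' * (a * a')" by (simp only: ac_simps)
    also have "a * a' = Fin (weight a + weight a')"
      using e(2) e'(2) by (cases a; cases a'; simp add: shift_edge_def)
    finally show "v * a * v' * a' = infimum (exc_values (x, (p, r))) *
        infimum (exc_values ((q, r + (weight a - weight d) - N), (p2, r2))) * Fin (weight a + weight a')"
      using v v' by (simp add: mem)
  qed (use v v' in \<open>simp_all add: mem\<close>)
  have base_exc: "covers base (q, Fin (- N - r')) (v * v')"
    if v: "((p, Fin (- N - r)), v) \<in> set base" and v': "(((p, r), (q, r')), v') \<in> set exc" for p r v q r' v'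
    by (rule covers_plus[OF tab(1), of "base_values (p, Fin (- N - r))" "exc_values ((p, r), (q, r'))" 0])
      (use v v' base_values_exc in \<open>simp_all add: mem flip: one_zmax_def\<close>)
  have base_upper_lower: "covers upper (p, - weight g - N) v \<and> covers lower (p, - weight g - N) (v * g)"
    if v: "((p, g), v) \<in> set base" and g: "g \<noteq> NegInf" "weight g \<le> - N" for p g v
  proof -
    have *: "x \<in> upper_values (p, - weight g - N)" "x + weight g \<in> lower_values (p, - weight g - N)"
      if "x \<in> base_values (p, g)" for x
    proof -
      have "reachable p (Fin x) (Fin (x + weight g))" "- (N + N) < weight g"
        using that g(1) unfolding base_values_def by (cases g; simp)+
      then show "x \<in> upper_values (p, - weight g - N)" "x + weight g \<in> lower_values (p, - weight g - N)"
        using g(2) by (auto intro: upper_values_I[of _ _ _ 1] lower_values_I[of _ _ _ 1])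
    qed
    have "covers upper (p, - weight g - N) v"
      by (rule covers_shift[OF tab(2), of "base_values (p, g)" 0])
        (use v * in \<open>simp_all add: mem flip: one_zmax_def\<close>)
    moreover have "covers lower (p, - weight g - N) (v * g)"
      by (rule covers_shift[OF tab(3), of "base_values (p, g)" "weight g"])
        (use v * g(1) in \<open>auto simp add: mem\<close>, cases g, auto)
    ultimately show ?thesis ..
  qed
  have upper_exc: "covers upper y (v * v')" if v: "(x, v) \<in> set upper" and v': "((x, y), v') \<in> set exc"
    for x v y v'
    by (rule covers_plus[OF tab(2), of "upper_values x" "exc_values (x, y)" 0])
      (use v v' upper_values_exc in \<open>simp_all add: mem flip: one_zmax_def\<close>)
  have lower_exc: "covers lower (q, r') (v * v' * Fin (r - r'))"
    if v: "((p, r), v) \<in> set lower" and v': "(((p, r), (q, r')), v') \<in> set exc" for p r v q r' v'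
    by (rule covers_plus[OF tab(3), of "lower_values (p, r)" "exc_values ((p, r), (q, r'))" "r - r'"])
      (use v v' lower_values_exc in \<open>simp_all add: mem\<close>)
  have upper_step: "(shift_edge a b d \<and> N \<le> r + (weight a - weight d) \<longrightarrow>
           covers upper (q, r + (weight a - weight d) - N) (v * a)) \<and>
        (a \<noteq> NegInf \<and> (b \<noteq> NegInf \<or> d = NegInf) \<and> b \<le> a \<longrightarrow> covers base (q, gap a b) (v * a))"
    if v: "((p, r), v) \<in> set upper" and e: "(p, q, a, b, c, d) \<in> set Es" for p r v q a b c d
  proof (intro conjI impI; elim conjE)
    assume a: "shift_edge a b d" "N \<le> r + (weight a - weight d)"
    show "covers upper (q, r + (weight a - weight d) - N) (v * a)"
    proof (rule covers_shift[OF tab(2), of "upper_values (p, r)" "weight a"])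
      show "x + weight a \<in> upper_values (q, r + (weight a - weight d) - N)"
        if "x \<in> upper_values (p, r)" for x
        using upper_values_up[OF that e a] .
      show "v * a = infimum (upper_values (p, r)) * Fin (weight a)"
        using v a(1) by (cases a) (auto simp: mem shift_edge_def)
    qed (use v in \<open>simp add: mem\<close>)
  next
    assume a: "a \<noteq> NegInf" "b \<noteq> NegInf \<or> d = NegInf" "b \<le> a"
    show "covers base (q, gap a b) (v * a)"
    proof (rule covers_shift[OF tab(1), of "upper_values (p, r)" "weight a"])
      show "x + weight a \<in> base_values (q, gap a b)" if "x \<in> upper_values (p, r)" for x
        using base_values_I[OF upper_values_step[OF that e a] a(1) edge_small_gap(1)[OF e a(1)]] .
      show "v * a = infimum (upper_values (p, r)) * Fin (weight a)"
        using v a(1) by (cases a) (auto simp: mem)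
    qed (use v in \<open>simp add: mem\<close>)
  qed
  have lower_step: "(shift_edge a b d \<and> N \<le> r + (weight a - weight d) \<longrightarrow>
           covers lower (q, r + (weight a - weight d) - N) (v * d)) \<and>
        (a = NegInf \<and> b = NegInf \<and> d \<le> c \<longrightarrow>
           (if c = NegInf then \<exists>q'\<in>set dead. q' = q else covers base (q, gap c d) (v * c)))"
    if v: "((p, r), v) \<in> set lower" and e: "(p, q, a, b, c, d) \<in> set Es" for p r v q a b c d
  proof (intro conjI impI; elim conjE)
    assume a: "shift_edge a b d" "N \<le> r + (weight a - weight d)"
    show "covers lower (q, r + (weight a - weight d) - N) (v * d)"
    proof (rule covers_shift[OF tab(3), of "lower_values (p, r)" "weight d"])
      show "x + weight d \<in> lower_values (q, r + (weight a - weight d) - N)"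
        if "x \<in> lower_values (p, r)" for x
        using lower_values_up[OF that e a] .
      show "v * d = infimum (lower_values (p, r)) * Fin (weight d)"
        using v a(1) by (cases d) (auto simp: mem shift_edge_def)
    qed (use v in \<open>simp add: mem\<close>)
  next
    assume a: "a = NegInf" "b = NegInf" "d \<le> c"
    note step = lower_values_step[OF _ e[unfolded a(1,2)] a(3)]
    show "if c = NegInf then \<exists>q'\<in>set dead. q' = q else covers base (q, gap c d) (v * c)"
    proof (cases c)
      case NegInf
      obtain x where "x \<in> lower_values (p, r)" using v unfolding mem by blast
      from step[OF this] show ?thesis using dead_I NegInf by simp
    next
      case (Fin i)
      have "covers base (q, gap c d) (v * c)"
      proof (rule covers_shift[OF tab(1), of "lower_values (p, r)" i])
        show "x + i \<in> base_values (q, gap c d)" if "x \<in> lower_values (p, r)" for x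
          using base_values_I[OF step[OF that]] edge_small_gap(2)[OF e] Fin by simp
      qed (use v in \<open>simp_all add: mem Fin\<close>)
      then show ?thesis using Fin by simp
    qed
  qed
  have base_start: "covers base (s, NegInf) (Fin 0)"
    using reach.start[of "set Es" s]
    by (intro covers_shift[OF tab(1), of "{0}" 0]) (auto simp: base_values_def infimum_zero)
  have dead_step: "\<exists>q'\<in>set dead. q' = q" if "p \<in> set dead" "(p, q, a, b, c, d) \<in> set Es" for p q a b c d
    using reachable_step[OF _ that(2), of NegInf NegInf NegInf NegInf] that(1) unfolding dead by simp
  have dead_final: "p \<noteq> t" if "p \<in> set dead" for p
    using nonneg that unfolding dead by fastforce
  have base_final: "Fin 0 \<le> v" if "((t, g), v) \<in> set base" for g v
    using that nonneg unfolding mem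
    by (auto simp: base_values_def intro!: infimum_greatest)
  have upper_final: "Fin 0 \<le> v" if "((t, r), v) \<in> set upper" for r v
    using that nonneg unfolding mem
    by (auto intro!: infimum_greatest elim!: upper_values_D)
  have "certifies Es s t (N, dead, base, upper, lower, exc)"
    unfolding certifies_def case_prod_conv
  proof (intro conjI, goal_cases)
    case 1 show ?case by (rule N_pos)
  next
    case 2 show ?case using small_differences by blast
  next
    case 3 show ?case by (rule base_start)
  next
    case 4 show ?case using base_step by blast
  next
    case 5 show ?case using dead_step by blast
  next
    case 6 show ?case using exc_refl edge_nodes by fastforce
  next
    case 7 show ?case
      by (clarify, intro conjI impI, blast intro: exc_step, clarify, blast intro: exc_up_down)
  next
    case 8 show ?case by clarify (rule base_exc)
  next
    case 9 show ?case using base_upper_lower by blast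
  next
    case 10 show ?case by clarify (rule upper_exc)
  next
    case 11 show ?case by clarify (rule lower_exc)
  next
    case 12 show ?case using upper_step by blast
  next
    case 13 show ?case using lower_step by blast
  next
    case 14 show ?case using dead_final by blast
  next
    case 15 show ?case using base_final by blast
  next
    case 16 show ?case using upper_final by blast
  qed
  then show ?thesis ..
qed

end

corollary ex_certificate_iff:
  "(\<exists>C. certifies Es s t C) \<longleftrightarrow> (\<forall>u l. reach (set Es) s t u l \<longrightarrow> Fin 0 \<le> u)"
proof
  assume "\<exists>C. certifies Es s t C"
  then obtain N dead base upper lower exc where "certifies Es s t (N, dead, base, upper, lower, exc)"
    by (metis prod_cases3 prod_cases4)
  then interpret certificate Es s t N dead base upper lower exc by unfold_locales
  show "\<forall>u l. reach (set Es) s t u l \<longrightarrow> Fin 0 \<le> u" using no_negative_reach by blast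
next
  assume nonneg: "\<forall>u l. reach (set Es) s t u l \<longrightarrow> Fin 0 \<le> u"
  obtain N where "0 < N" "\<forall>x\<in>set Es. small_differences N x" using ex_small_differences by blast
  with nonneg interpret nonnegative_system Es s t N by unfold_locales blast+
  show "\<exists>C. certifies Es s t C" by (rule ex_certificate)
qed

subsection \<open>Decidability of nonnegativity\<close>

lemma computable_gap [computable_intros]:
  "computable f \<Longrightarrow> computable g \<Longrightarrow> computable (\<lambda>x. gap (f x) (g x))"
  unfolding gap_def by (intro computable_intros)

lemma computable_pred_shift_edge [computable_intros]:
  "computable f \<Longrightarrow> computable g \<Longrightarrow> computable h \<Longrightarrow> computable_pred (\<lambda>x. shift_edge (f x) (g x) (h x))"
  unfolding shift_edge_def by (intro computable_intros)

lemma computable_pred_covers [computable_intros]: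
  assumes "computable f" "computable g" "computable h"
  shows "computable_pred (\<lambda>x. covers (f x) (g x) (h x))"
proof -
  \<comment> \<open>Under the quantifier the argument is paired with the bound variable, so the
    assumptions are reused after a projection.\<close>
  note weaken = computable_comp[OF computable_fst[OF computable_id]]
  show ?thesis unfolding covers_def case_prod_unfold
    by (intro computable_intros weaken[OF assms(2)] weaken[OF assms(3)] assms(1))
qed

text \<open>The form of \<open>certifies\<close> is chosen for this proof: its quantifiers range
  over lists, and membership in \<open>dead\<close> and in \<open>covers\<close> is spelled as a
  bounded existential, so the closure rules apply directly.\<close>

lemma computable_pred_certifies:
  "computable_pred (\<lambda>z :: ('p::coded edge list \<times> 'p \<times> 'p) \<times> 'p certificate.
     certifies (fst (fst z)) (fst (snd (fst z))) (snd (snd (fst z))) (snd z))"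
  unfolding certifies_def small_differences_def case_prod_unfold
  by (intro computable_intros)


text \<open>Paths of exactly \<open>n\<close> edges yield a finite list, so a negative vector at the
  final state is found by searching through \<open>n\<close>. This makes the failure of
  nonnegativity semidecidable.\<close>

definition reach_list :: "'p edge list \<Rightarrow> 'p \<Rightarrow> nat \<Rightarrow> ('p \<times> zmax \<times> zmax) list" where
  "reach_list Es s n = rec_nat [(s, Fin 0, NegInf)]
    (\<lambda>_ cs. concat (map (\<lambda>(p, u, l). concat (map (\<lambda>(p', q, a, b, c, d).
       if p' = p \<and> u * b + l * d \<le> u * a + l * c then [(q, u * a + l * c, u * b + l * d)] else [])
       Es)) cs)) n"

lemma reach_list_Suc:
  "reach_list Es s (Suc n) = concat (map (\<lambda>(p, u, l). concat (map (\<lambda>(p', q, a, b, c, d).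
       if p' = p \<and> u * b + l * d \<le> u * a + l * c then [(q, u * a + l * c, u * b + l * d)] else [])
       Es)) (reach_list Es s n))"
  by (simp add: reach_list_def)

lemma reach_iff_reach_list:
  "reach (set Es) s p u l \<longleftrightarrow> (\<exists>n. (p, u, l) \<in> set (reach_list Es s n))"
proof
  show "reach (set Es) s p u l \<Longrightarrow> \<exists>n. (p, u, l) \<in> set (reach_list Es s n)"
  proof (induction rule: reach.induct)
    case start
    have "(s, Fin 0, NegInf) \<in> set (reach_list Es s 0)" by (simp add: reach_list_def)
    then show ?case ..
  next
    case (step p u l q a b c d)
    then obtain n where "(p, u, l) \<in> set (reach_list Es s n)" by blast
    then have "(q, u * a + l * c, u * b + l * d) \<in> set (reach_list Es s (Suc n))"
      using step.hyps(2,3) unfolding reach_list_Suc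
      by (auto intro!: bexI[of _ "(p, u, l)"] bexI[of _ "(p, q, a, b, c, d)"])
    then show ?case ..
  qed
next
  have "(p, u, l) \<in> set (reach_list Es s n) \<Longrightarrow> reach (set Es) s p u l" for n
  proof (induction n arbitrary: p u l)
    case 0
    then show ?case by (simp add: reach_list_def reach.start)
  next
    case (Suc n)
    then show ?case unfolding reach_list_Suc
      by (auto split: if_splits intro: reach.step)
  qed
  then show "\<exists>n. (p, u, l) \<in> set (reach_list Es s n) \<Longrightarrow> reach (set Es) s p u l" by blast
qed

theorem computable_pred_nonnegative:
  "computable_pred (\<lambda>(Es :: 'p::coded edge list, s, t). \<forall>u l. reach (set Es) s t u l \<longrightarrow> Fin 0 \<le> u)"
proof (rule computable_pred_by_search)
  show "computable_pred (\<lambda>z :: ('p edge list \<times> 'p \<times> 'p) \<times> 'p certificate.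
     certifies (fst (fst z)) (fst (snd (fst z))) (snd (snd (fst z))) (snd z))"
    by (rule computable_pred_certifies)
  show "computable_pred (\<lambda>z :: ('p edge list \<times> 'p \<times> 'p) \<times> nat.
      \<exists>c\<in>set (reach_list (fst (fst z)) (fst (snd (fst z))) (snd z)).
        fst c = snd (snd (fst z)) \<and> fst (snd c) < Fin 0)"
    unfolding reach_list_def case_prod_unfold by (intro computable_intros)
  show "(case x of (Es :: 'p edge list, s, t) \<Rightarrow> \<forall>u l. reach (set Es) s t u l \<longrightarrow> Fin 0 \<le> u) \<longleftrightarrow>
      (\<exists>C. certifies (fst x) (fst (snd x)) (snd (snd x)) C)" for x
    unfolding case_prod_unfold ex_certificate_iff ..
  show "\<not> (case x of (Es :: 'p edge list, s, t) \<Rightarrow> \<forall>u l. reach (set Es) s t u l \<longrightarrow> Fin 0 \<le> u) \<longleftrightarrow>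
      (\<exists>n. \<exists>c\<in>set (reach_list (fst x) (fst (snd x)) n).
        fst c = snd (snd x) \<and> fst (snd c) < Fin 0)" for x
    unfolding case_prod_unfold reach_iff_reach_list not_le[symmetric] by force
qed

section \<open>From automata to one-counter systems\<close>

text \<open>The components of a vector of \<open>B\<close> occur in either order, so this is
  \<open>reach\<close> without the order condition; \<open>oriented\<close> mediates between the
  two.\<close>

inductive vector_reach :: "'q edge set \<Rightarrow> 'q \<Rightarrow> 'q \<Rightarrow> zmax \<Rightarrow> zmax \<Rightarrow> bool" for E s where
  start: "vector_reach E s s (Fin 0) NegInf"
| step: "vector_reach E s p x y \<Longrightarrow> (p, q, a, b, c, d) \<in> E \<Longrightarrow>
    vector_reach E s q (x * a + y * c) (x * b + y * d)"

text \<open>In state \<open>(q, 1)\<close> the two components of the vector are swapped.\<close>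

definition oriented :: "'q edge list \<Rightarrow> ('q \<times> nat) edge list" where
  "oriented Es = concat (map (\<lambda>(p, q, a, b, c, d).
     [((p, 0), (q, 0), a, b, c, d), ((p, 0), (q, 1), b, a, d, c),
      ((p, 1), (q, 0), c, d, a, b), ((p, 1), (q, 1), d, c, b, a)]) Es)"

lemma oriented_edges:
  "(p, q, a, b, c, d) \<in> set Es \<Longrightarrow> ((p, 0), (q, 0), a, b, c, d) \<in> set (oriented Es)"
  "(p, q, a, b, c, d) \<in> set Es \<Longrightarrow> ((p, 0), (q, 1), b, a, d, c) \<in> set (oriented Es)"
  "(p, q, a, b, c, d) \<in> set Es \<Longrightarrow> ((p, 1), (q, 0), c, d, a, b) \<in> set (oriented Es)"
  "(p, q, a, b, c, d) \<in> set Es \<Longrightarrow> ((p, 1), (q, 1), d, c, b, a) \<in> set (oriented Es)"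
  unfolding oriented_def by (auto intro!: bexI[of _ "(p, q, a, b, c, d)"])

text \<open>An edge is present for both orientations of its target, and the order condition of
  \<open>reach\<close> admits the one that sorts the new vector, or both in the case of a
  tie.\<close>

lemma vector_reach_oriented:
  assumes "vector_reach (set Es) s p x y"
  shows "(y \<le> x \<longrightarrow> reach (set (oriented Es)) (s, 0) (p, 0) x y) \<and>
    (x \<le> y \<longrightarrow> reach (set (oriented Es)) (s, 0) (p, 1) y x)"
  using assms
proof induction
  case start
  show ?case by (auto intro: reach.start)
next
  case (step p x y q a b c d)
  note e = oriented_edges[OF step.hyps(2)]
  show ?case
  proof (cases "y \<le> x")
    case True
    then have "reach (set (oriented Es)) (s, 0) (p, 0) x y" using step.IH by blast
    from reach.step[OF this e(1)] reach.step[OF this e(2)] show ?thesis by blast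
  next
    case False
    then have "reach (set (oriented Es)) (s, 0) (p, 1) y x" using step.IH by auto
    from reach.step[OF this e(3)] reach.step[OF this e(4)] show ?thesis by (simp add: add.commute)
  qed
qed

lemma oriented_vector_reach:
  assumes "reach (set (oriented Es)) (s, 0) P u l"
  shows "(snd P = 0 \<and> vector_reach (set Es) s (fst P) u l) \<or> (snd P = 1 \<and> vector_reach (set Es) s (fst P) l u)"
  using assms
proof induction
  case start
  show ?case by (simp add: vector_reach.start)
next
  case (step P u l Q a b c d)
  have step': "vector_reach (set Es) s q z w"
    if "vector_reach (set Es) s p x y" "(p, q, a, b, c, d) \<in> set Es" "z = x * a + y * c" "w = x * b + y * d"
    for p q x y z w a b c d
    using vector_reach.step[OF that(1,2)] that(3,4) by simp
  from step.hyps(2) step.IH show ?case unfolding oriented_def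
    by (auto intro: step' simp: add.commute)
qed

section \<open>Automata as nested lists, padded with zeros of the semiring\<close>

type_synonym raw_automaton = "nat \<times> zmax list \<times> zmax list list list \<times> zmax list"

abbreviation raw_states :: "raw_automaton \<Rightarrow> nat" where
  "raw_states C \<equiv> fst C"

abbreviation raw_initial :: "raw_automaton \<Rightarrow> nat \<Rightarrow> zmax" where
  "raw_initial C p \<equiv> entry (fst (snd C)) p"

abbreviation raw_transition :: "raw_automaton \<Rightarrow> nat \<Rightarrow> nat \<Rightarrow> nat \<Rightarrow> zmax" where
  "raw_transition C \<sigma> p q \<equiv> entry (entry (entry (fst (snd (snd C))) \<sigma>) p) q"

abbreviation raw_final :: "raw_automaton \<Rightarrow> nat \<Rightarrow> zmax" where
  "raw_final C p \<equiv> entry (snd (snd (snd C))) p"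

text \<open>The number \<open>m\<close> of states is a separate argument so that \<open>B\<close>
  can always be read with two states: entries out of range are \<open>NegInf\<close> and contribute
  nothing.\<close>

fun raw_value :: "raw_automaton \<Rightarrow> nat \<Rightarrow> nat list \<Rightarrow> nat \<Rightarrow> zmax" where
  "raw_value C m [] p = raw_final C p"
| "raw_value C m (\<sigma> # w) p = (\<Sum>q<m. raw_transition C \<sigma> p q * raw_value C m w q)"

definition raw_series :: "raw_automaton \<Rightarrow> nat \<Rightarrow> nat list \<Rightarrow> zmax" where
  "raw_series C m w = (\<Sum>p<m. raw_initial C p * raw_value C m w p)"

definition raw_of :: "nat \<Rightarrow> mp_automaton \<Rightarrow> raw_automaton" where
  "raw_of k C = (states C, list_of_vec (initial C),
     map (\<lambda>\<sigma>. map list_of_vec (rows (transition C \<sigma>))) [0..<k], list_of_vec (final C))"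

lemma dec_0_zmax: "dec 0 = (0 :: zmax)"
  by (metis dec_enc enc_zmax_def code_zmax.simps(1) zero_zmax_def)

lemma dec_0_list: "dec 0 = []"
  by (metis dec_enc enc_Nil)

lemma entry_list_of_vec:
  "entry (list_of_vec v) i = (if i < dim_vec v then v $ i else (0 :: zmax))"
  by (simp add: entry_eq dec_0_zmax)

lemma raw_transition_raw_of:
  assumes "valid_mp_automaton k C" "\<sigma> < k"
  shows "raw_transition (raw_of k C) \<sigma> p q =
    (if p < states C \<and> q < states C then transition C \<sigma> $$ (p, q) else 0)"
proof -
  have "transition C \<sigma> \<in> carrier_mat (states C) (states C)"
    using assms by (simp add: valid_mp_automaton_def)
  then show ?thesis using assms(2)
    by (auto simp: raw_of_def entry_eq[of "map _ _"] entry_eq[of "[]"] entry_list_of_vec dec_0_list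
        dec_0_zmax)
qed

lemma sum_pad:
  fixes f :: "nat \<Rightarrow> zmax"
  assumes "n \<le> m" "\<And>i. n \<le> i \<Longrightarrow> f i = 0"
  shows "sum f {..<m} = sum f {0..<n}"
  using assms by (intro sum.mono_neutral_right) auto

lemma raw_value_raw_of:
  assumes valid: "valid_mp_automaton k C" and m: "states C \<le> m" and "w \<in> lists {..<k}" and "p < states C"
  shows "raw_value (raw_of k C) m w p = (word_mat C w *\<^sub>v final C) $ p"
  using assms(3,4)
proof (induction w arbitrary: p)
  case Nil
  then show ?case using valid
    by (auto simp: raw_of_def entry_list_of_vec valid_mp_automaton_def dest: carrier_vecD)
next
  case (Cons \<sigma> w)
  have final: "final C \<in> carrier_vec (states C)" using valid by (simp add: valid_mp_automaton_def)
  have mat: "word_mat C w \<in> carrier_mat (states C) (states C)" if "w \<in> lists {..<k}" for w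
    using that valid by (induction w) (auto simp: valid_mp_automaton_def)
  have \<sigma>: "transition C \<sigma> \<in> carrier_mat (states C) (states C)" "\<sigma> < k"
    using valid Cons.hyps by (auto simp: valid_mp_automaton_def)
  have w: "w \<in> lists {..<k}" using Cons.hyps by simp
  have "raw_value (raw_of k C) m (\<sigma> # w) p =
      (\<Sum>q = 0..<states C. raw_transition (raw_of k C) \<sigma> p q * raw_value (raw_of k C) m w q)"
    unfolding raw_value.simps by (rule sum_pad[OF m]) (simp add: raw_transition_raw_of[OF valid \<sigma>(2)])
  also have "\<dots> = (\<Sum>q = 0..<states C. transition C \<sigma> $$ (p, q) * (word_mat C w *\<^sub>v final C) $ q)"
    using Cons by (intro sum.cong refl) (simp add: raw_transition_raw_of[OF valid \<sigma>(2)])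
  also have "\<dots> = (transition C \<sigma> *\<^sub>v (word_mat C w *\<^sub>v final C)) $ p"
    using Cons.prems \<sigma>(1) mat[OF w] final by (auto simp: scalar_prod_def intro!: sum.cong)
  also have "transition C \<sigma> *\<^sub>v (word_mat C w *\<^sub>v final C) = word_mat C (\<sigma> # w) *\<^sub>v final C"
    using assoc_mult_mat_vec[OF \<sigma>(1) mat[OF w] final] by simp
  finally show ?case .
qed

lemma raw_series_raw_of:
  assumes valid: "valid_mp_automaton k C" and m: "states C \<le> m" and w: "w \<in> lists {..<k}"
  shows "raw_series (raw_of k C) m w = series C w"
proof -
  have init: "initial C \<in> carrier_vec (states C)" using valid by (simp add: valid_mp_automaton_def)
  have mat: "word_mat C w \<in> carrier_mat (states C) (states C)"
    using w valid by (induction w) (auto simp: valid_mp_automaton_def)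
  have "raw_initial (raw_of k C) p = (if p < states C then initial C $ p else 0)" for p
    using init by (simp add: raw_of_def entry_list_of_vec)
  then have "raw_series (raw_of k C) m w = (\<Sum>p = 0..<states C. initial C $ p * (word_mat C w *\<^sub>v final C) $ p)"
    unfolding raw_series_def
    by (subst sum_pad[OF m]) (auto intro!: sum.cong simp: raw_value_raw_of[OF valid m w])
  then show ?thesis using mat by (simp add: series_def scalar_prod_def)
qed

text \<open>Sums are maxima, so a single summand witnesses the strict inequality; this is how a run
  is extracted from the series of \<open>A\<close>. The empty sum is \<open>NegInf\<close>, which
  exceeds nothing.\<close>

lemma zmax_sum_less_iff:
  fixes f :: "'i \<Rightarrow> zmax"
  assumes "finite S"
  shows "v < sum f S \<longleftrightarrow> (\<exists>i\<in>S. v < f i)"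
  using assms by (induction S) (auto simp: plus_zmax_def less_max_iff_disj zero_zmax_def)

lemma zmax_le_sum:
  fixes f :: "'i \<Rightarrow> zmax"
  assumes "finite S" "i \<in> S"
  shows "f i \<le> sum f S"
  using zmax_sum_less_iff[OF assms(1), of "sum f S" f] assms(2) by (meson less_irrefl not_le)

text \<open>
  To the states \<open>{..<n}\<close> of \<open>A\<close> a source \<open>n\<close> and a sink \<open>Suc n\<close> are added: the edges out of the source
  carry the initial weights, and those into the sink the final weights.
\<close>

definition difference_edges :: "nat \<Rightarrow> raw_automaton \<Rightarrow> raw_automaton \<Rightarrow> nat edge list" where
  "difference_edges k A B =
     concat (map (\<lambda>\<sigma>. concat (map (\<lambda>p. concat (map (\<lambda>q. let a = raw_transition A \<sigma> p q in
       if a = NegInf then [] else [(p, q,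
         raw_transition B \<sigma> 0 0 * Fin (- weight a), raw_transition B \<sigma> 0 1 * Fin (- weight a),
         raw_transition B \<sigma> 1 0 * Fin (- weight a), raw_transition B \<sigma> 1 1 * Fin (- weight a))])
       [0..<raw_states A])) [0..<raw_states A])) [0..<k]) @
     concat (map (\<lambda>q. let a = raw_initial A q in if a = NegInf then [] else [(raw_states A, q,
         raw_initial B 0 * Fin (- weight a), raw_initial B 1 * Fin (- weight a), NegInf, NegInf)])
       [0..<raw_states A]) @
     concat (map (\<lambda>p. let a = raw_final A p in if a = NegInf then [] else [(p, Suc (raw_states A),
         raw_final B 0 * Fin (- weight a), NegInf, raw_final B 1 * Fin (- weight a), NegInf)])
       [0..<raw_states A])"

inductive difference_edge :: "nat \<Rightarrow> raw_automaton \<Rightarrow> raw_automaton \<Rightarrow>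
    nat \<Rightarrow> nat \<Rightarrow> zmax \<Rightarrow> zmax \<Rightarrow> zmax \<Rightarrow> zmax \<Rightarrow> bool" for k A B where
  transition: "\<sigma> < k \<Longrightarrow> p < raw_states A \<Longrightarrow> q < raw_states A \<Longrightarrow> raw_transition A \<sigma> p q = Fin a \<Longrightarrow>
    difference_edge k A B p q (raw_transition B \<sigma> 0 0 * Fin (- a)) (raw_transition B \<sigma> 0 1 * Fin (- a))
      (raw_transition B \<sigma> 1 0 * Fin (- a)) (raw_transition B \<sigma> 1 1 * Fin (- a))"
| initial: "q < raw_states A \<Longrightarrow> raw_initial A q = Fin a \<Longrightarrow>
    difference_edge k A B (raw_states A) q (raw_initial B 0 * Fin (- a)) (raw_initial B 1 * Fin (- a))
      NegInf NegInf"
| final: "p < raw_states A \<Longrightarrow> raw_final A p = Fin a \<Longrightarrow>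
    difference_edge k A B p (Suc (raw_states A)) (raw_final B 0 * Fin (- a)) NegInf
      (raw_final B 1 * Fin (- a)) NegInf"

lemma NegInf_neq_iff: "x \<noteq> NegInf \<longleftrightarrow> x = Fin (weight x)"
  by (cases x) auto

lemma difference_edges_iff:
  "(p, q, a, b, c, d) \<in> set (difference_edges k A B) \<longleftrightarrow> difference_edge k A B p q a b c d"
proof
  show "(p, q, a, b, c, d) \<in> set (difference_edges k A B) \<Longrightarrow> difference_edge k A B p q a b c d"
    unfolding difference_edges_def Let_def
    by (auto split: if_splits simp: NegInf_neq_iff intro: difference_edge.intros[simplified])
  assume "difference_edge k A B p q a b c d"
  then show "(p, q, a, b, c, d) \<in> set (difference_edges k A B)"
    unfolding difference_edges_def Let_def by cases force+
qed

lemma Fin_0_times: "Fin 0 * x = x"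
  by (cases x) auto

section \<open>Counterexample words and negative vectors at the sink\<close>

context
  fixes k :: nat and A B :: raw_automaton
begin

abbreviation A_value :: "nat list \<Rightarrow> nat \<Rightarrow> zmax" where
  "A_value \<equiv> raw_value A (raw_states A)"

definition B_value :: "nat list \<Rightarrow> zmax \<Rightarrow> zmax \<Rightarrow> zmax" where
  "B_value w x y = x * raw_value B 2 w 0 + y * raw_value B 2 w 1"

abbreviation vr :: "nat \<Rightarrow> zmax \<Rightarrow> zmax \<Rightarrow> bool" where
  "vr \<equiv> vector_reach (set (difference_edges k A B)) (raw_states A)"

lemma vr_step:
  assumes "vr p x y" "difference_edge k A B p q a b c d" "x' = x * a + y * c" "y' = x * b + y * d"
  shows "vr q x' y'"
  using assms vector_reach.step by (metis difference_edges_iff)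

lemma sum_lessThan_2: "(\<Sum>i<2. f i) = f 0 + f (1 :: nat)"
  by (simp add: numeral_2_eq_2)

lemma B_value_Nil: "B_value [] x y = x * raw_final B 0 + y * raw_final B 1"
  by (simp add: B_value_def)

lemma B_value_Cons:
  "B_value (\<sigma> # w) x y = B_value w
    (x * raw_transition B \<sigma> 0 0 + y * raw_transition B \<sigma> 1 0)
    (x * raw_transition B \<sigma> 0 1 + y * raw_transition B \<sigma> 1 1)"
  unfolding B_value_def raw_value.simps sum_lessThan_2 by (simp add: algebra_simps)

lemma B_value_scale: "B_value w (x * c) (y * c) = B_value w x y * c"
  unfolding B_value_def by (simp add: algebra_simps)

lemma raw_series_B: "raw_series B 2 w = B_value w (raw_initial B 0) (raw_initial B 1)"
  unfolding B_value_def raw_series_def sum_lessThan_2 ..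

lemma less_Fin_times: "x < Fin a * y \<Longrightarrow> x * Fin (- a) < y"
  by (cases x; cases y) auto

text \<open>At each letter some successor state of \<open>A\<close> already exceeds the value of
  \<open>B\<close>, and subtracting the weight of that transition preserves the strict inequality.
  At the end of the word the excess is a negative first component at the sink.\<close>

lemma ex_negative:
  assumes "B_value w x y < A_value w p" "w \<in> lists {..<k}" "p < raw_states A" "vr p x y"
  shows "\<exists>x y. vr (Suc (raw_states A)) x y \<and> x < Fin 0"
  using assms
proof (induction w arbitrary: p x y)
  case Nil
  then obtain a where a: "raw_final A p = Fin a" by (cases "raw_final A p") auto
  define z where "z = x * (raw_final B 0 * Fin (- a)) + y * (raw_final B 1 * Fin (- a))"
  have "vr (Suc (raw_states A)) z NegInf"
    using Nil(3,4)
    by (intro vr_step[OF _ difference_edge.final[OF _ a]]) (simp_all add: z_def)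
  moreover have "z = B_value [] x y * Fin (- a)"
    unfolding z_def B_value_Nil by (simp add: algebra_simps)
  then have "z < Fin 0"
    using Nil(1) less_Fin_times[of "B_value [] x y" a "Fin 0"] by (simp add: a)
  ultimately show ?case by blast
next
  case (Cons \<sigma> w)
  then obtain q where q: "q < raw_states A"
    and less: "B_value (\<sigma> # w) x y < raw_transition A \<sigma> p q * A_value w q"
    unfolding raw_value.simps by (auto simp: zmax_sum_less_iff)
  then obtain a where a: "raw_transition A \<sigma> p q = Fin a" by (cases "raw_transition A \<sigma> p q") auto
  define x' where "x' = x * (raw_transition B \<sigma> 0 0 * Fin (- a)) + y * (raw_transition B \<sigma> 1 0 * Fin (- a))"
  define y' where "y' = x * (raw_transition B \<sigma> 0 1 * Fin (- a)) + y * (raw_transition B \<sigma> 1 1 * Fin (- a))"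
  have "vr q x' y'"
    using Cons.prems q
    by (intro vr_step[OF _ difference_edge.transition[OF _ _ _ a]]) (simp_all add: x'_def y'_def)
  moreover have "B_value w x' y' = B_value (\<sigma> # w) x y * Fin (- a)"
    unfolding B_value_Cons B_value_scale[symmetric] x'_def y'_def by (simp add: algebra_simps)
  then have "B_value w x' y' < A_value w q"
    using less_Fin_times[of _ a] less by (simp add: a)
  ultimately show ?case using Cons.IH Cons.prems q by auto
qed

text \<open>A vector at a state of \<open>A\<close> stems from a prefix \<open>v\<close> and a run
  of weight \<open>e\<close> on it. For \<open>B\<close> this gives an equation, for
  \<open>A\<close> only an inequality, as the run need not be optimal. All continuations
  \<open>w\<close> are considered so that the induction can append a letter to
  \<open>v\<close>.\<close>

lemma vr_word:
  assumes "vr p x y"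
  shows "(p = raw_states A \<longrightarrow> x = Fin 0 \<and> y = NegInf) \<and>
    (p < raw_states A \<longrightarrow> (\<exists>v\<in>lists {..<k}. \<exists>e. \<forall>w.
       raw_series B 2 (v @ w) * Fin (- e) = B_value w x y \<and>
       Fin e * A_value w p \<le> raw_series A (raw_states A) (v @ w))) \<and>
    (p = Suc (raw_states A) \<longrightarrow> y = NegInf \<and>
      (x < Fin 0 \<longrightarrow> (\<exists>v\<in>lists {..<k}. raw_series B 2 v < raw_series A (raw_states A) v)))"
  using assms
proof induction
  case start
  then show ?case by simp
next
  case (step p x y q a b c d)
  from step.hyps(2) have "difference_edge k A B p q a b c d" by (simp add: difference_edges_iff)
  then show ?case
  proof cases
    case (transition \<sigma> i)
    obtain v e where v: "v \<in> lists {..<k}"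
      and B: "\<And>w. raw_series B 2 (v @ w) * Fin (- e) = B_value w x y"
      and A: "\<And>w. Fin e * A_value w p \<le> raw_series A (raw_states A) (v @ w)"
      using step.IH transition(6) by blast
    have "raw_series B 2 ((v @ [\<sigma>]) @ w) * Fin (- (e + i)) = B_value w (x * a + y * c) (x * b + y * d)" for w
    proof -
      have "raw_series B 2 ((v @ [\<sigma>]) @ w) * Fin (- (e + i)) =
          (raw_series B 2 (v @ \<sigma> # w) * Fin (- e)) * Fin (- i)"
        by (simp add: mult.assoc)
      also have "\<dots> = B_value w (x * a + y * c) (x * b + y * d)"
        unfolding B B_value_Cons B_value_scale[symmetric] transition(1-4) by (simp add: algebra_simps)
      finally show ?thesis .
    qed
    moreover have "Fin (e + i) * A_value w q \<le> raw_series A (raw_states A) ((v @ [\<sigma>]) @ w)" for w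
    proof -
      have "Fin (e + i) * A_value w q = Fin e * (raw_transition A \<sigma> p q * A_value w q)"
        by (simp add: transition(8) flip: mult.assoc)
      also have "\<dots> \<le> Fin e * A_value (\<sigma> # w) p"
        using zmax_le_sum[of "{..<raw_states A}" q "\<lambda>q. raw_transition A \<sigma> p q * A_value w q"] transition(7)
        by simp
      also have "\<dots> \<le> raw_series A (raw_states A) ((v @ [\<sigma>]) @ w)" using A[of "\<sigma> # w"] by simp
      finally show ?thesis .
    qed
    moreover have "v @ [\<sigma>] \<in> lists {..<k}" using v transition(5) by simp
    ultimately show ?thesis using transition(7) by (auto intro!: bexI[of _ "v @ [\<sigma>]"] exI[of _ "e + i"])
  next
    case (initial i)
    have x: "x = Fin 0" "y = NegInf" using step.IH initial(1) by auto
    have "raw_series B 2 ([] @ w) * Fin (- i) = B_value w (x * a + y * c) (x * b + y * d)" for w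
      unfolding append.simps raw_series_B B_value_scale[symmetric] initial(2-5) x
      by (simp flip: one_zmax_def)
    moreover have "Fin i * A_value w q \<le> raw_series A (raw_states A) ([] @ w)" for w
      using zmax_le_sum[of "{..<raw_states A}" q "\<lambda>q. raw_initial A q * A_value w q"] initial(6,7)
      by (simp add: raw_series_def)
    ultimately show ?thesis using initial(6) by (auto intro!: bexI[of _ "[]"] exI[of _ i])
  next
    case (final i)
    obtain v e where v: "v \<in> lists {..<k}"
      and B: "\<And>w. raw_series B 2 (v @ w) * Fin (- e) = B_value w x y"
      and A: "\<And>w. Fin e * A_value w p \<le> raw_series A (raw_states A) (v @ w)"
      using step.IH final(6) by blast
    have "x * a + y * c = raw_series B 2 v * Fin (- e) * Fin (- i)"
      using B[of "[]"] unfolding B_value_Nil final(2,4) by (simp add: algebra_simps)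
    moreover have "Fin e * Fin i \<le> raw_series A (raw_states A) v"
      using A[of "[]"] by (simp add: final(7))
    ultimately have "x * a + y * c < Fin 0 \<Longrightarrow> raw_series B 2 v < raw_series A (raw_states A) v"
      by (cases "raw_series B 2 v"; cases "raw_series A (raw_states A) v") auto
    then show ?thesis using v final(1,3,5) by auto
  qed
qed

lemma series_le_iff_nonnegative:
  "(\<forall>w\<in>lists {..<k}. raw_series A (raw_states A) w \<le> raw_series B 2 w) \<longleftrightarrow>
    (\<forall>u l. reach (set (oriented (difference_edges k A B)))
      (raw_states A, 0) (Suc (raw_states A), 0) u l \<longrightarrow> Fin 0 \<le> u)"
proof -
  \<comment> \<open>Vectors at the sink have second component \<open>NegInf\<close>, hence are
    sorted in orientation 0, and one target state suffices.\<close>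
  have "(\<exists>u l. reach (set (oriented (difference_edges k A B)))
      (raw_states A, 0) (Suc (raw_states A), 0) u l \<and> u < Fin 0) \<longleftrightarrow>
      (\<exists>x y. vr (Suc (raw_states A)) x y \<and> x < Fin 0)"
    using oriented_vector_reach[of "difference_edges k A B" "raw_states A" "(Suc (raw_states A), 0)"]
      vector_reach_oriented[of "difference_edges k A B" "raw_states A" "Suc (raw_states A)"]
      vr_word[of "Suc (raw_states A)"] by fastforce
  also have "\<dots> \<longleftrightarrow> (\<exists>w\<in>lists {..<k}. raw_series B 2 w < raw_series A (raw_states A) w)"
  proof
    assume "\<exists>x y. vr (Suc (raw_states A)) x y \<and> x < Fin 0"
    then show "\<exists>w\<in>lists {..<k}. raw_series B 2 w < raw_series A (raw_states A) w" using vr_word by blast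
  next
    assume "\<exists>w\<in>lists {..<k}. raw_series B 2 w < raw_series A (raw_states A) w"
    then obtain w q where w: "w \<in> lists {..<k}" "q < raw_states A"
      and less: "raw_series B 2 w < raw_initial A q * A_value w q"
      unfolding raw_series_def[of A] by (auto simp: zmax_sum_less_iff)
    then obtain i where i: "raw_initial A q = Fin i" by (cases "raw_initial A q") auto
    have "vr q (raw_initial B 0 * Fin (- i)) (raw_initial B 1 * Fin (- i))"
      using vr_step[OF vector_reach.start difference_edge.initial[OF w(2) i] refl refl]
      by (simp add: Fin_0_times)
    moreover have "B_value w (raw_initial B 0 * Fin (- i)) (raw_initial B 1 * Fin (- i)) < A_value w q"
      using less_Fin_times less unfolding B_value_scale raw_series_B i by blast
    ultimately show "\<exists>x y. vr (Suc (raw_states A)) x y \<and> x < Fin 0" using ex_negative w by blast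
  qed
  finally show ?thesis by (meson not_le)
qed

end

section \<open>Decoding instances\<close>

lemma computable_oriented [computable_intros]:
  "computable f \<Longrightarrow> computable (\<lambda>x. oriented (f x))"
  unfolding oriented_def case_prod_unfold by (intro computable_intros)

lemma computable_difference_edges [computable_intros]:
  assumes "computable f" "computable g" "computable h"
  shows "computable (\<lambda>x. difference_edges (f x) (g x) (h x))"
proof -
  note weaken = computable_comp[OF computable_fst[OF computable_id]]
  \<comment> \<open>The edges are listed by up to three nested maps, and each bound variable moves
    the inputs one projection deeper.\<close>
  note weaken' = assms assms[THEN weaken] assms[THEN weaken, THEN weaken]
    assms[THEN weaken, THEN weaken, THEN weaken]
  show ?thesis unfolding difference_edges_def Let_def
    by (intro computable_intros weaken')
qed

text \<open>The fields have different types, so the code is read as a list of numbers, and all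
  fields but the number of states are decoded once more.\<close>

definition decode_automaton :: "nat \<Rightarrow> raw_automaton" where
  "decode_automaton c = (entry (dec c) 0, dec (entry (dec c) 1), dec (entry (dec c) 2), dec (entry (dec c) 3))"

lemma computable_decode_automaton [computable_intros]:
  "computable f \<Longrightarrow> computable (\<lambda>x. decode_automaton (f x))"
  unfolding decode_automaton_def by (intro computable_intros)

lemma enc_nat_list: "enc ns = list_encode (ns :: nat list)"
  by (simp add: enc_list_def enc_nat_def[abs_def])

lemma dec_list_encode: "dec (list_encode ns) = (ns :: nat list)"
  by (metis dec_enc enc_nat_list)

lemma dec_code_vec: "dec (code_vec v) = list_of_vec v"
proof -
  have "code_vec v = enc (list_of_vec v)"
    by (simp add: code_vec_def enc_list_def enc_zmax_def)
  then show ?thesis by simp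
qed

lemma dec_code_mats: "dec (list_encode (map code_mat Ms)) = map (\<lambda>M. map list_of_vec (rows M)) Ms"
proof -
  have "list_encode (map code_mat Ms) = enc (map (\<lambda>M. map list_of_vec (rows M)) Ms)"
    by (simp add: code_mat_def[abs_def] code_vec_def[abs_def] enc_list_def[abs_def] enc_zmax_def comp_def)
  then show ?thesis by simp
qed

lemma decode_code_automaton: "decode_automaton (code_automaton k A) = raw_of k A"
  using dec_code_mats[of "map (transition A) [0..<k]"]
  unfolding decode_automaton_def code_automaton_def dec_list_encode
  by (simp add: entry_eq raw_of_def dec_code_vec comp_def)

theorem theorem1p1:
  shows "decidable code_instance
    {(k, A, B). valid_mp_automaton k A \<and> valid_mp_automaton k B \<and> states B \<le> 2}
    (\<lambda>(k, A, B). \<forall>w\<in>lists {..<k}. series A w \<le> series B w)"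
proof -
  define system where "system c = (let A = decode_automaton (entry (dec c) 1);
      B = decode_automaton (entry (dec c) 2) in
    (oriented (difference_edges (entry (dec c) 0) A B), (raw_states A, 0 :: nat), (Suc (raw_states A), 0 :: nat)))"
    for c :: nat
  define Q where "Q c = (case system c of (Es, s, t) \<Rightarrow> \<forall>u l. reach (set Es) s t u l \<longrightarrow> Fin 0 \<le> u)" for c
  have "computable system"
    unfolding system_def[abs_def] Let_def by (intro computable_intros)
  then have "computable_pred Q"
    unfolding Q_def[abs_def] by (rule computable_pred_comp) (rule computable_pred_nonnegative)
  then obtain p where p: "\<And>xs. length xs = 1 \<Longrightarrow> computes p xs (of_bool (Q (xs ! 0)))"
    unfolding computable_pred_def computable_def recursive_def by (auto simp: enc_nat_def dec_nat)
  have correct: "Q (code_instance (k, A, B)) \<longleftrightarrow> (\<forall>w\<in>lists {..<k}. series A w \<le> series B w)"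
    if valid: "valid_mp_automaton k A" "valid_mp_automaton k B" "states B \<le> 2" for k A B
  proof -
    have "system (code_instance (k, A, B)) = (oriented (difference_edges k (raw_of k A) (raw_of k B)),
        (raw_states (raw_of k A), 0), (Suc (raw_states (raw_of k A)), 0))"
      unfolding system_def code_instance.simps dec_list_encode
      by (simp add: entry_eq Let_def decode_code_automaton)
    then have "Q (code_instance (k, A, B)) \<longleftrightarrow> (\<forall>w\<in>lists {..<k}.
        raw_series (raw_of k A) (raw_states (raw_of k A)) w \<le> raw_series (raw_of k B) 2 w)"
      unfolding Q_def series_le_iff_nonnegative by simp
    moreover have "raw_states (raw_of k A) = states A" by (simp add: raw_of_def)
    \<comment> \<open>\<open>raw_series_raw_of\<close> is applied with \<open>m = states A\<close>
      to \<open>A\<close> and with \<open>m = 2\<close> to \<open>B\<close>; the latter is where the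
      bound on the number of states of \<open>B\<close> enters.\<close>
    ultimately show ?thesis using valid by (simp add: raw_series_raw_of)
  qed
  have computes_p: "computes p [c] (if Q c then 1 else 0)" for c
    using p[of "[c]"] by (simp add: of_bool_def)
  show ?thesis
    unfolding decidable_def
  proof (intro exI ballI)
    fix x
    assume "x \<in> {(k, A, B). valid_mp_automaton k A \<and> valid_mp_automaton k B \<and> states B \<le> 2}"
    then obtain k A B where x: "x = (k, A, B)"
      and valid: "valid_mp_automaton k A" "valid_mp_automaton k B" "states B \<le> 2"
      by blast
    show "computes p [code_instance x]
        (if case x of (k, A, B) \<Rightarrow> \<forall>w\<in>lists {..<k}. series A w \<le> series B w then 1 else 0)"
      using computes_p[of "code_instance x"] unfolding x case_prod_conv correct[OF valid] .
  qed
qed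

end
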